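(* There exists a non-amenable countable discrete group with non-trivial amenable radical that has the ISR property.
   Context: For a countable discrete group $G$, $L(G)$ is the group von Neumann algebra, generated by the left translation unitaries $u_g$ on $\ell^2(G)$; for a subgroup $H\le G$, $L(H)$ is identified with the von Neumann subalgebra of $L(G)$ generated by $\{u_h:h\in H\}$. A (unital) von Neumann subalgebra $P\subseteq L(G)$ is $G$-invariant if $u_gPu_g^*=P$ for all $g\in G$. $G$ has the ISR property (invariant von Neumann subalgebras rigidity) if every $G$-invariant von Neumann subalgebra $P\subseteq L(G)$ equals $L(H)$ for some normal subgroup $H\lhd G$. The amenable radical of a group is its largest amenable normal subgroup. *)

theory Defs
  imports "HOL-Analysis.Analysis" "HOL-Algebra.Coset"
begin

section \<open>Bounded operators on square-summable families\<close>

text \<open>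
  Vectors indexed by a set \<open>S\<close> are functions on the whole type that vanish outside \<open>S\<close>.
  Operators are functions that are extensional on \<open>ell2 S\<close>, so that equality of operators
  is equality in HOL; they are composed with \<^const>\<open>compose\<close>.
\<close>

definition ell2 :: "'a set \<Rightarrow> ('a \<Rightarrow> complex) set" where
  "ell2 S = {\<xi>. (\<forall>x. x \<notin> S \<longrightarrow> \<xi> x = 0) \<and> (\<lambda>x. (cmod (\<xi> x))\<^sup>2) summable_on S}"

definition ell2_inner :: "'a set \<Rightarrow> ('a \<Rightarrow> complex) \<Rightarrow> ('a \<Rightarrow> complex) \<Rightarrow> complex" where
  "ell2_inner S \<xi> \<eta> = (\<Sum>\<^sub>\<infinity>x\<in>S. \<xi> x * cnj (\<eta> x))"

definition ell2_norm :: "'a set \<Rightarrow> ('a \<Rightarrow> complex) \<Rightarrow> real" where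
  "ell2_norm S \<xi> = sqrt (\<Sum>\<^sub>\<infinity>x\<in>S. (cmod (\<xi> x))\<^sup>2)"

type_synonym 'a operator = "('a \<Rightarrow> complex) \<Rightarrow> ('a \<Rightarrow> complex)"

definition bounded_operators :: "'a set \<Rightarrow> 'a operator set" where
  "bounded_operators S = {T \<in> ell2 S \<rightarrow>\<^sub>E ell2 S.
     (\<forall>\<xi>\<in>ell2 S. \<forall>\<eta>\<in>ell2 S. T (\<lambda>x. \<xi> x + \<eta> x) = (\<lambda>x. T \<xi> x + T \<eta> x)) \<and>
     (\<forall>c. \<forall>\<xi>\<in>ell2 S. T (\<lambda>x. c * \<xi> x) = (\<lambda>x. c * T \<xi> x)) \<and>
     (\<exists>C. \<forall>\<xi>\<in>ell2 S. ell2_norm S (T \<xi>) \<le> C * ell2_norm S \<xi>)}"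

definition op_id :: "'a set \<Rightarrow> 'a operator" where
  "op_id S = (\<lambda>\<xi>\<in>ell2 S. \<xi>)"

definition op_add :: "'a set \<Rightarrow> 'a operator \<Rightarrow> 'a operator \<Rightarrow> 'a operator" where
  "op_add S T U = (\<lambda>\<xi>\<in>ell2 S. \<lambda>x. T \<xi> x + U \<xi> x)"

definition op_scale :: "'a set \<Rightarrow> complex \<Rightarrow> 'a operator \<Rightarrow> 'a operator" where
  "op_scale S c T = (\<lambda>\<xi>\<in>ell2 S. \<lambda>x. c * T \<xi> x)"

definition op_mult :: "'a set \<Rightarrow> 'a operator \<Rightarrow> 'a operator \<Rightarrow> 'a operator" where
  "op_mult S T U = compose (ell2 S) T U"

text \<open>The adjoint exists and is unique for every bounded operator, by Riesz representation.\<close>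

definition op_adjoint :: "'a set \<Rightarrow> 'a operator \<Rightarrow> 'a operator" where
  "op_adjoint S T = (THE U. U \<in> bounded_operators S \<and>
     (\<forall>\<xi>\<in>ell2 S. \<forall>\<eta>\<in>ell2 S. ell2_inner S (T \<xi>) \<eta> = ell2_inner S \<xi> (U \<eta>)))"


section \<open>Von Neumann algebras\<close>

text \<open>
  The weak operator topology is the coarsest topology on the bounded operators for which all
  matrix coefficients \<open>T \<mapsto> \<langle>T \<xi>, \<eta>\<rangle>\<close> are continuous.
\<close>

definition weak_operator_topology :: "'a set \<Rightarrow> 'a operator topology" where
  "weak_operator_topology S =
     pullback_topology (bounded_operators S)
       (\<lambda>T. \<lambda>(\<xi>, \<eta>)\<in>ell2 S \<times> ell2 S. ell2_inner S (T \<xi>) \<eta>)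
       (product_topology (\<lambda>_. euclidean) (ell2 S \<times> ell2 S))"

definition von_neumann_algebra :: "'a set \<Rightarrow> 'a operator set \<Rightarrow> bool" where
  "von_neumann_algebra S M \<longleftrightarrow>
     M \<subseteq> bounded_operators S \<and>
     op_id S \<in> M \<and>
     (\<forall>T\<in>M. \<forall>U\<in>M. op_add S T U \<in> M) \<and>
     (\<forall>c. \<forall>T\<in>M. op_scale S c T \<in> M) \<and>
     (\<forall>T\<in>M. \<forall>U\<in>M. op_mult S T U \<in> M) \<and>
     (\<forall>T\<in>M. op_adjoint S T \<in> M) \<and>
     closedin (weak_operator_topology S) M"

definition vn_generated :: "'a set \<Rightarrow> 'a operator set \<Rightarrow> 'a operator set" where
  "vn_generated S X = \<Inter>{M. von_neumann_algebra S M \<and> X \<subseteq> M}"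


section \<open>Group von Neumann algebras and the ISR property\<close>

definition left_translation :: "('a, 'b) monoid_scheme \<Rightarrow> 'a \<Rightarrow> 'a operator" where
  "left_translation G g =
     (\<lambda>\<xi>\<in>ell2 (carrier G). \<lambda>x. if x \<in> carrier G then \<xi> (inv\<^bsub>G\<^esub> g \<otimes>\<^bsub>G\<^esub> x) else 0)"

text \<open>
  \<open>group_vn_algebra G H\<close> is \<open>L(H)\<close> regarded as a subalgebra of \<open>L(G)\<close>, acting on
  the square-summable families over \<open>G\<close>; \<open>L(G)\<close> itself is the case \<open>H = carrier G\<close>.
\<close>

definition group_vn_algebra :: "('a, 'b) monoid_scheme \<Rightarrow> 'a set \<Rightarrow> 'a operator set" where
  "group_vn_algebra G H = vn_generated (carrier G) (left_translation G ` H)"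

definition invariant_vn_subalgebra :: "('a, 'b) monoid_scheme \<Rightarrow> 'a operator set \<Rightarrow> bool" where
  "invariant_vn_subalgebra G P \<longleftrightarrow>
     von_neumann_algebra (carrier G) P \<and>
     P \<subseteq> group_vn_algebra G (carrier G) \<and>
     (\<forall>g\<in>carrier G.
        (\<lambda>T. op_mult (carrier G) (op_mult (carrier G) (left_translation G g) T)
               (op_adjoint (carrier G) (left_translation G g))) ` P = P)"

definition ISR_property :: "('a, 'b) monoid_scheme \<Rightarrow> bool" where
  "ISR_property G \<longleftrightarrow>
     (\<forall>P. invariant_vn_subalgebra G P \<longrightarrow> (\<exists>H. H \<lhd> G \<and> P = group_vn_algebra G H))"


section \<open>Amenability\<close>

text \<open>
  Amenability of a discrete group in von Neumann's sense. Only the values of \<open>m\<close> on subsets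
  of the carrier matter.
\<close>

definition amenable :: "('a, 'b) monoid_scheme \<Rightarrow> bool" where
  "amenable G \<longleftrightarrow>
     (\<exists>m :: 'a set \<Rightarrow> real.
        (\<forall>A. A \<subseteq> carrier G \<longrightarrow> 0 \<le> m A) \<and>
        m (carrier G) = 1 \<and>
        (\<forall>A B. A \<subseteq> carrier G \<and> B \<subseteq> carrier G \<and> A \<inter> B = {} \<longrightarrow> m (A \<union> B) = m A + m B) \<and>
        (\<forall>g A. g \<in> carrier G \<and> A \<subseteq> carrier G \<longrightarrow> m (g <#\<^bsub>G\<^esub> A) = m A))"

definition is_amenable_radical :: "('a, 'b) monoid_scheme \<Rightarrow> 'a set \<Rightarrow> bool" where
  "is_amenable_radical G R \<longleftrightarrow>
     R \<lhd> G \<and> amenable (G\<lparr>carrier := R\<rparr>) \<and>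
     (\<forall>N. N \<lhd> G \<and> amenable (G\<lparr>carrier := N\<rparr>) \<longrightarrow> N \<subseteq> R)"

end

(*
  Idea. Let G be the group of all permutations of the set X of words over a countable alphabet
  which, up to finitely many points, are left multiplication by an element of the free product
  F of countably many copies of Z/2. Its finitary permutations form a locally finite, hence
  amenable, normal subgroup R with quotient F. A normal subgroup N containing an element outside
  R contains, for three letters t not occurring in its reduced word u, elements acting like t u t;
  these map the elements of N whose reduced word does not start with t to ones that do, which is
  impossible for an invariant mean. So R is the amenable radical, and G is not amenable.

  Rigidity holds for every group G of permutations of an infinite set which contains the finitary
  ones. For an invariant subalgebra P let p be the projection onto the closure of P delta_1, and
  put v g = p delta_g. By invariance, v g is constant on orbits of the conjugation action of the
  centralizer of g, so it is supported on elements with finite orbits. For a 3-cycle s this leaves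
  v s = a s + b s^-1, and p^2 = p gives v s = 0, v s = delta_s or v s = (s + e s^-1)/2 with e = 1 or
  e = -1. The last case is excluded by multiplying two such elements. If v s = delta_s then P
  contains all 3-cycles, and invariance under them makes v g a multiple of delta_g for all g. If
  v s = 0 then a conjugation trick with Bessel's inequality gives v g = 0, first for finitary g,
  then for every g other than 1. So v g is 0 or delta_g for all g, and P = L(H) for
  H = {g. v g = delta_g}. The passage from the vectors to the operators is the double commutant
  theorem together with the trace property of L(G).
*)
theory Submission
  imports Defs
begin

section \<open>The Hilbert space of square-summable families\<close>

text \<open>\<open>p\<close> plays the part of the conditional expectation of \<open>L(G)\<close>
  onto \<open>P\<close>: \<open>v g\<close> is the vector of the expectation of the unitary of
  \<open>g\<close>. The obstacle is the way back, since a vector in the closure need not come from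
  an operator of \<open>P\<close>. For operators known to commute with right translations it is
  overcome: convergence of their vectors suffices, because the trace bounds an operator and its
  adjoint on all basis vectors by one number.

  The trace also gives \<open>v s = 0\<close> its force: it makes the closure orthogonal to its
  translate by \<open>s\<close>. The conjugation trick takes infinitely many conjugates of
  \<open>g\<close> whose mutual quotients are such \<open>s\<close>; transpositions with a common
  point as conjugators make the quotients 3-cycles or at least finitary.

  Generators of order two make the elements of F plain lists, inverted by reversal. Infinitely many
  letters let an element of F be recognized, despite finitary changes, on words of length one. Three
  letters \<open>t\<close> are taken because each yields a set of mean at least 1/2, which is no
  contradiction for two disjoint sets.\<close>

typedef 'a l2 = "ell2 (UNIV :: 'a set)"
  morphisms coord l2_of
  by (rule exI[of _ "\<lambda>_. 0"]) (simp add: ell2_def)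

setup_lifting type_definition_l2

lemma ell2_UNIV: "\<xi> \<in> ell2 UNIV \<longleftrightarrow> (\<lambda>x. (cmod (\<xi> x))\<^sup>2) summable_on UNIV"
  by (simp add: ell2_def)

lemma summable_coord: "(\<lambda>x. (cmod (coord \<xi> x))\<^sup>2) summable_on UNIV"
  using coord[of \<xi>] by (simp add: ell2_UNIV)

lemma l2_eqI: "(\<And>x. coord \<xi> x = coord \<eta> x) \<Longrightarrow> \<xi> = \<eta>"
  by (simp add: coord_inject[symmetric] ext)

lemma ell2_add:
  assumes "\<xi> \<in> ell2 UNIV" "\<eta> \<in> ell2 UNIV"
  shows "(\<lambda>x. \<xi> x + \<eta> x) \<in> ell2 (UNIV :: 'a set)"
proof -
  have "(\<lambda>x. 2 * ((cmod (\<xi> x))\<^sup>2 + (cmod (\<eta> x))\<^sup>2)) summable_on UNIV"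
    using assms by (intro summable_on_cmult_right summable_on_add) (auto simp: ell2_UNIV)
  moreover have "(cmod (\<xi> x + \<eta> x))\<^sup>2 \<le> 2 * ((cmod (\<xi> x))\<^sup>2 + (cmod (\<eta> x))\<^sup>2)" for x
  proof -
    have "(cmod (\<xi> x + \<eta> x))\<^sup>2 \<le> (cmod (\<xi> x) + cmod (\<eta> x))\<^sup>2"
      by (intro power_mono norm_triangle_ineq) auto
    also have "\<dots> \<le> 2 * ((cmod (\<xi> x))\<^sup>2 + (cmod (\<eta> x))\<^sup>2)"
      using sum_squares_bound[of "cmod (\<xi> x)" "cmod (\<eta> x)"] by (simp add: power2_sum)
    finally show ?thesis .
  qed
  ultimately show ?thesis
    unfolding ell2_UNIV by (rule summable_on_comparison_test) auto
qed

lemma ell2_scale: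
  assumes "\<xi> \<in> ell2 UNIV"
  shows "(\<lambda>x. c * \<xi> x) \<in> ell2 (UNIV :: 'a set)"
proof -
  have "(\<lambda>x. (cmod c)\<^sup>2 * (cmod (\<xi> x))\<^sup>2) summable_on UNIV"
    using assms by (intro summable_on_cmult_right) (auto simp: ell2_UNIV)
  then show ?thesis
    by (simp add: ell2_UNIV norm_mult power_mult_distrib)
qed

instantiation l2 :: (type) real_vector
begin

lift_definition zero_l2 :: "'a l2" is "\<lambda>_. 0"
  by (simp add: ell2_UNIV)
lift_definition plus_l2 :: "'a l2 \<Rightarrow> 'a l2 \<Rightarrow> 'a l2" is "\<lambda>\<xi> \<eta> x. \<xi> x + \<eta> x"
  by (rule ell2_add)
lift_definition uminus_l2 :: "'a l2 \<Rightarrow> 'a l2" is "\<lambda>\<xi> x. - \<xi> x"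
  by (simp add: ell2_UNIV)
lift_definition minus_l2 :: "'a l2 \<Rightarrow> 'a l2 \<Rightarrow> 'a l2" is "\<lambda>\<xi> \<eta> x. \<xi> x - \<eta> x"
  subgoal for \<xi> \<eta>
    using ell2_add[of \<xi> "\<lambda>x. - 1 * \<eta> x"] ell2_scale[of \<eta> "-1"] by simp
  done
lift_definition scaleR_l2 :: "real \<Rightarrow> 'a l2 \<Rightarrow> 'a l2" is "\<lambda>r \<xi> x. of_real r * \<xi> x"
  by (rule ell2_scale)

instance
  by standard (transfer; simp add: algebra_simps fun_eq_iff)+

end

lemma coord_zero [simp]: "coord 0 x = 0"
  and coord_add [simp]: "coord (\<xi> + \<eta>) x = coord \<xi> x + coord \<eta> x"
  and coord_diff [simp]: "coord (\<xi> - \<eta>) x = coord \<xi> x - coord \<eta> x"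
  by (transfer; simp)+

text \<open>The type is organized as a real Hilbert space whose inner product is the real part of
  \<open>cip\<close>. Complex scalars act through this operation, and complex statements are
  recovered for maps that commute with it.\<close>

lift_definition cscale :: "complex \<Rightarrow> 'a l2 \<Rightarrow> 'a l2" is "\<lambda>c \<xi> x. c * \<xi> x"
  by (rule ell2_scale)

lemma coord_cscale [simp]: "coord (cscale c \<xi>) x = c * coord \<xi> x"
  by transfer simp

lemma scaleR_cscale: "r *\<^sub>R \<xi> = cscale (of_real r) \<xi>"
  by transfer simp

lemma coord_sum [simp]: "coord (sum f A) x = (\<Sum>i\<in>A. coord (f i) x)"
  by (induction A rule: infinite_finite_induct) auto

definition cip :: "'a l2 \<Rightarrow> 'a l2 \<Rightarrow> complex" where
  "cip \<xi> \<eta> = (\<Sum>\<^sub>\<infinity>x. coord \<xi> x * cnj (coord \<eta> x))"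

lemma summable_cip: "(\<lambda>x. coord \<xi> x * cnj (coord \<eta> x)) summable_on UNIV"
proof -
  have "(\<lambda>x. norm (coord \<xi> x * cnj (coord \<eta> x))) summable_on UNIV"
  proof (rule summable_on_comparison_test)
    show "(\<lambda>x. (cmod (coord \<xi> x))\<^sup>2 + (cmod (coord \<eta> x))\<^sup>2) summable_on UNIV"
      by (intro summable_on_add summable_coord)
    fix x
    show "norm (coord \<xi> x * cnj (coord \<eta> x)) \<le> (cmod (coord \<xi> x))\<^sup>2 + (cmod (coord \<eta> x))\<^sup>2"
      using sum_squares_bound[of "cmod (coord \<xi> x)" "cmod (coord \<eta> x)"]
        mult_nonneg_nonneg[OF norm_ge_zero[of "coord \<xi> x"] norm_ge_zero[of "coord \<eta> x"]]
      unfolding norm_mult complex_mod_cnj mult.assoc by linarith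
  qed auto
  then show ?thesis by (rule abs_summable_summable)
qed

lemma cip_add_left: "cip (\<xi> + \<xi>') \<eta> = cip \<xi> \<eta> + cip \<xi>' \<eta>"
  by (simp add: cip_def distrib_right infsum_add summable_cip)

lemma cip_cscale_left: "cip (cscale c \<xi>) \<eta> = c * cip \<xi> \<eta>"
  by (simp add: cip_def mult.assoc infsum_cmult_right summable_cip)

lemma cip_cnj: "cnj (cip \<xi> \<eta>) = cip \<eta> \<xi>"
  unfolding cip_def infsum_cnj[symmetric] by (simp add: mult.commute)

lemma cip_self: "cip \<xi> \<xi> = of_real (\<Sum>\<^sub>\<infinity>x. (cmod (coord \<xi> x))\<^sup>2)"
proof -
  have "((\<lambda>x. (cmod (coord \<xi> x))\<^sup>2) has_sum (\<Sum>\<^sub>\<infinity>x. (cmod (coord \<xi> x))\<^sup>2)) UNIV"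
    by (simp add: summable_coord)
  then have "((\<lambda>x. of_real ((cmod (coord \<xi> x))\<^sup>2)) has_sum
      (of_real (\<Sum>\<^sub>\<infinity>x. (cmod (coord \<xi> x))\<^sup>2) :: complex)) UNIV"
    by (rule has_sum_of_real)
  then show ?thesis
    unfolding cip_def complex_norm_square[symmetric] by (rule infsumI)
qed

instantiation l2 :: (type) real_inner
begin

definition inner_l2 :: "'a l2 \<Rightarrow> 'a l2 \<Rightarrow> real" where
  "inner_l2 \<xi> \<eta> = Re (cip \<xi> \<eta>)"
definition norm_l2 :: "'a l2 \<Rightarrow> real" where
  "norm_l2 \<xi> = sqrt (inner \<xi> \<xi>)"
definition sgn_l2 :: "'a l2 \<Rightarrow> 'a l2" where
  "sgn_l2 \<xi> = \<xi> /\<^sub>R norm \<xi>"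
definition dist_l2 :: "'a l2 \<Rightarrow> 'a l2 \<Rightarrow> real" where
  "dist_l2 \<xi> \<eta> = norm (\<xi> - \<eta>)"
definition uniformity_l2 :: "('a l2 \<times> 'a l2) filter" where
  "uniformity_l2 = (INF e\<in>{0<..}. principal {(\<xi>, \<eta>). dist \<xi> \<eta> < e})"
definition open_l2 :: "'a l2 set \<Rightarrow> bool" where
  "open_l2 U = (\<forall>\<xi>\<in>U. \<forall>\<^sub>F (\<xi>', \<eta>) in uniformity. \<xi>' = \<xi> \<longrightarrow> \<eta> \<in> U)"

instance
proof
  fix \<xi> \<eta> \<zeta> :: "'a l2" and r :: real
  show "inner \<xi> \<eta> = inner \<eta> \<xi>"
    unfolding inner_l2_def by (subst cip_cnj[symmetric]) simp
  show "inner (\<xi> + \<eta>) \<zeta> = inner \<xi> \<zeta> + inner \<eta> \<zeta>"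
    by (simp add: inner_l2_def cip_add_left)
  show "inner (r *\<^sub>R \<xi>) \<eta> = r * inner \<xi> \<eta>"
    by (simp add: inner_l2_def scaleR_cscale cip_cscale_left)
  show "0 \<le> inner \<xi> \<xi>"
    by (simp add: inner_l2_def cip_self infsum_nonneg)
  show "inner \<xi> \<xi> = 0 \<longleftrightarrow> \<xi> = 0"
  proof
    assume "inner \<xi> \<xi> = 0"
    then have "(\<Sum>\<^sub>\<infinity>x. (cmod (coord \<xi> x))\<^sup>2) \<le> 0"
      by (simp add: inner_l2_def cip_self)
    then have "(cmod (coord \<xi> x))\<^sup>2 = 0" for x
      by (rule nonneg_infsum_le_0D) (auto simp: summable_coord)
    then show "\<xi> = 0" by (intro l2_eqI) simp
  qed (simp add: inner_l2_def cip_def)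
  show "norm \<xi> = sqrt (inner \<xi> \<xi>)" by (rule norm_l2_def)
  show "sgn \<xi> = \<xi> /\<^sub>R norm \<xi>" by (rule sgn_l2_def)
  show "dist \<xi> \<eta> = norm (\<xi> - \<eta>)" by (rule dist_l2_def)
  show "uniformity = (INF e\<in>{0<..}. principal {(\<xi>, \<eta> :: 'a l2). dist \<xi> \<eta> < e})"
    by (rule uniformity_l2_def)
  show "open U = (\<forall>\<xi>\<in>U. \<forall>\<^sub>F (\<xi>', \<eta>) in uniformity. \<xi>' = \<xi> \<longrightarrow> \<eta> \<in> U)" for U :: "'a l2 set"
    by (rule open_l2_def)
qed

end

lemma norm_l2_sq: "(norm \<xi>)\<^sup>2 = (\<Sum>\<^sub>\<infinity>x. (cmod (coord \<xi> x))\<^sup>2)"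
  by (simp add: power2_norm_eq_inner inner_l2_def cip_self)

lemma norm_l2_ell2: "norm \<xi> = ell2_norm UNIV (coord \<xi>)"
  by (simp add: norm_l2_def inner_l2_def cip_self ell2_norm_def)

lemma cip_self_norm: "cip \<xi> \<xi> = of_real ((norm \<xi>)\<^sup>2)"
  by (simp add: norm_l2_sq cip_self)

lemma sum_coord_le: "finite F \<Longrightarrow> (\<Sum>x\<in>F. (cmod (coord \<xi> x))\<^sup>2) \<le> (norm \<xi>)\<^sup>2"
  unfolding norm_l2_sq by (intro finite_sum_le_infsum summable_coord) auto

lemma coord_le_norm: "cmod (coord \<xi> x) \<le> norm \<xi>"
  using sum_coord_le[of "{x}" \<xi>] by (simp add: power2_le_iff_abs_le)

text \<open>Serves to recognize a function obtained only coordinatewise as an element of the space,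
  with a bound on its norm.\<close>

lemma finite_sum_le_imp_l2:
  assumes "\<And>F. finite F \<Longrightarrow> (\<Sum>x\<in>F. (cmod (\<xi> x))\<^sup>2) \<le> B"
  obtains \<xi>' where "coord \<xi>' = \<xi>" "(norm \<xi>')\<^sup>2 \<le> B"
proof -
  have s: "(\<lambda>x. (cmod (\<xi> x))\<^sup>2) summable_on UNIV"
    by (intro nonneg_bdd_above_summable_on bdd_aboveI[of _ B]) (use assms in auto)
  then have c: "coord (l2_of \<xi>) = \<xi>"
    by (simp add: l2_of_inverse ell2_UNIV)
  moreover have "(norm (l2_of \<xi>))\<^sup>2 \<le> B"
    unfolding norm_l2_sq c using s assms by (intro infsum_le_finite_sums) auto
  ultimately show ?thesis using that by blast
qed

lemma norm_cscale [simp]: "norm (cscale c \<xi>) = cmod c * norm \<xi>"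
proof -
  have "(norm (cscale c \<xi>))\<^sup>2 = (cmod c * norm \<xi>)\<^sup>2"
    by (simp add: norm_l2_sq power_mult_distrib norm_mult infsum_cmult_right' )
  then show ?thesis by (simp add: power2_eq_iff_nonneg)
qed

instance l2 :: (type) complete_space
proof
  fix X :: "nat \<Rightarrow> 'a l2"
  assume X: "Cauchy X"
  have "Cauchy (\<lambda>n. coord (X n) x)" for x
  proof (rule CauchyI)
    fix e :: real assume "0 < e"
    then obtain M where "\<forall>m\<ge>M. \<forall>n\<ge>M. norm (X m - X n) < e" using X CauchyD by blast
    then show "\<exists>M. \<forall>m\<ge>M. \<forall>n\<ge>M. norm (coord (X m) x - coord (X n) x) < e"
      using order_le_less_trans[OF coord_le_norm[of "X _ - X _" x]] by (intro exI[of _ M]) auto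
  qed
  then have "\<forall>x. \<exists>l. (\<lambda>n. coord (X n) x) \<longlonglongrightarrow> l"
    using Cauchy_convergent convergent_def by blast
  then obtain L where L: "\<And>x. (\<lambda>n. coord (X n) x) \<longlonglongrightarrow> L x" by metis
  \<comment> \<open>A finite partial sum passes to the coordinatewise limit, and the bound does not
    depend on \<open>F\<close>.\<close>
  have tail: "(\<Sum>x\<in>F. (cmod (coord (X n) x - L x))\<^sup>2) \<le> e\<^sup>2"
    if "\<forall>m\<ge>n. norm (X n - X m) \<le> e" "finite F" for F n e
  proof (rule tendsto_upperbound)
    show "(\<lambda>m. \<Sum>x\<in>F. (cmod (coord (X n) x - coord (X m) x))\<^sup>2) \<longlonglongrightarrow>
        (\<Sum>x\<in>F. (cmod (coord (X n) x - L x))\<^sup>2)"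
      by (intro tendsto_intros L)
    have "(\<Sum>x\<in>F. (cmod (coord (X n) x - coord (X m) x))\<^sup>2) \<le> e\<^sup>2" if "m \<ge> n" for m
      using sum_coord_le[OF \<open>finite F\<close>, of "X n - X m"] that
        \<open>\<forall>m\<ge>n. norm (X n - X m) \<le> e\<close> power_mono[of "norm (X n - X m)" e 2] by fastforce
    then show "\<forall>\<^sub>F m in sequentially. (\<Sum>x\<in>F. (cmod (coord (X n) x - coord (X m) x))\<^sup>2) \<le> e\<^sup>2"
      using eventually_sequentially by blast
  qed auto
  have near: "\<exists>N. \<forall>n\<ge>N. \<forall>m\<ge>n. norm (X n - X m) \<le> e" if "0 < e" for e
    using CauchyD[OF X that] by (meson less_imp_le order_trans)
  obtain N where N: "\<forall>n\<ge>N. \<forall>m\<ge>n. norm (X n - X m) \<le> 1" using near[of 1] by auto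
  \<comment> \<open>\<open>L\<close> is not yet known to be square summable, but its difference from
    one term of the sequence is; the limit is therefore built as \<open>X N - D\<close>.\<close>
  obtain D where D: "coord D = (\<lambda>x. coord (X N) x - L x)"
    by (rule finite_sum_le_imp_l2[of "\<lambda>x. coord (X N) x - L x" "1\<^sup>2"]) (use tail[of N 1] N in auto)
  have "X \<longlonglongrightarrow> X N - D"
  proof (rule LIMSEQ_I)
    fix e :: real assume "0 < e"
    obtain M where M: "\<forall>n\<ge>M. \<forall>m\<ge>n. norm (X n - X m) \<le> e / 2"
      using near[of "e / 2"] \<open>0 < e\<close> by auto
    have "norm (X n - (X N - D)) < e" if "n \<ge> M" for n
    proof -
      obtain D' where D': "coord D' = (\<lambda>x. coord (X n) x - L x)" "(norm D')\<^sup>2 \<le> (e / 2)\<^sup>2"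
        by (rule finite_sum_le_imp_l2[of "\<lambda>x. coord (X n) x - L x" "(e / 2)\<^sup>2"])
          (use tail[of n "e / 2"] M \<open>n \<ge> M\<close> in auto)
      have "D' = X n - (X N - D)"
        by (intro l2_eqI) (simp add: D' D)
      moreover have "norm D' \<le> e / 2"
        using D'(2) \<open>0 < e\<close> by (simp add: power2_le_iff_abs_le)
      ultimately show ?thesis using \<open>0 < e\<close> by simp
    qed
    then show "\<exists>M. \<forall>n\<ge>M. norm (X n - (X N - D)) < e" by blast
  qed
  then show "convergent X" by (auto simp: convergent_def)
qed

section \<open>Orthogonal projections and adjoints\<close>

lemma parallelogram:
  fixes x y :: "'a::real_inner"
  shows "(norm (x + y))\<^sup>2 + (norm (x - y))\<^sup>2 = 2 * (norm x)\<^sup>2 + 2 * (norm y)\<^sup>2"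
  by (simp add: power2_norm_eq_inner inner_add_left inner_add_right inner_diff_left
      inner_diff_right inner_commute)

lemma ex_orthogonal_projection:
  fixes V :: "'a::{real_inner, complete_space} set"
  assumes V: "subspace V" "closed V"
  shows "\<exists>y\<in>V. \<forall>v\<in>V. inner (x - y) v = 0"
proof -
  define d where "d = (INF v\<in>V. (norm (x - v))\<^sup>2)"
  have 0: "0 \<in> V" using V(1) subspace_0 by blast
  have bdd: "bdd_below ((\<lambda>v. (norm (x - v))\<^sup>2) ` V)"
    by (intro bdd_belowI[of _ 0]) auto
  have d_le: "d \<le> (norm (x - v))\<^sup>2" if "v \<in> V" for v
    unfolding d_def by (rule cINF_lower[OF bdd that])
  have "\<exists>v\<in>V. (norm (x - v))\<^sup>2 < d + 1 / real (Suc n)" for n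
    using cInf_lessD[of "(\<lambda>v. (norm (x - v))\<^sup>2) ` V" "d + 1 / real (Suc n)"] 0
    by (auto simp: d_def)
  then obtain s where s: "\<And>n. s n \<in> V" "\<And>n. (norm (x - s n))\<^sup>2 < d + 1 / real (Suc n)"
    by metis
  have dist: "(norm (s m - s n))\<^sup>2 \<le> 4 / real (Suc k)" if "m \<ge> k" "n \<ge> k" for m n k
  proof -
    have mid: "(1/2) *\<^sub>R (s m + s n) \<in> V"
      using s(1) V(1) by (simp add: subspace_add subspace_scale)
    \<comment> \<open>The midpoint of \<open>s m\<close> and \<open>s n\<close> lies in
      \<open>V\<close>, so its squared distance from \<open>x\<close> is at least \<open>d\<close>;
      by the parallelogram law a minimizing sequence is then Cauchy.\<close>
    have "(x - s m) + (x - s n) = 2 *\<^sub>R (x - (1/2) *\<^sub>R (s m + s n))"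
      by (simp add: algebra_simps scaleR_2)
    then have "(norm ((x - s m) + (x - s n)))\<^sup>2 = 4 * (norm (x - (1/2) *\<^sub>R (s m + s n)))\<^sup>2"
      by (simp add: power_mult_distrib)
    then have "(norm ((x - s m) + (x - s n)))\<^sup>2 \<ge> 4 * d"
      using d_le[OF mid] by simp
    moreover have "norm ((x - s m) - (x - s n)) = norm (s m - s n)"
      by (simp add: norm_minus_commute)
    ultimately have "(norm (s m - s n))\<^sup>2 \<le> 2 / real (Suc m) + 2 / real (Suc n)"
      using parallelogram[of "x - s m" "x - s n"] s(2)[of m] s(2)[of n] by simp
    also have "\<dots> \<le> 2 / real (Suc k) + 2 / real (Suc k)"
      using that by (intro add_mono divide_left_mono) auto
    finally show ?thesis by simp
  qed
  have "Cauchy s"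
  proof (rule CauchyI)
    fix e :: real assume "0 < e"
    then obtain k where k: "4 / e\<^sup>2 < real k" using reals_Archimedean2 by blast
    have "norm (s m - s n) < e" if "m \<ge> k" "n \<ge> k" for m n
    proof -
      have "4 < e\<^sup>2 * real (Suc k)" using k \<open>0 < e\<close>
        by (simp add: divide_less_eq algebra_simps) (smt (verit) zero_less_power)
      then have "(norm (s m - s n))\<^sup>2 < e\<^sup>2"
        using dist[OF that] by (smt (verit) divide_less_eq of_nat_0_less_iff zero_less_Suc)
      then show ?thesis using \<open>0 < e\<close> by (simp add: power2_less_imp_less)
    qed
    then show "\<exists>M. \<forall>m\<ge>M. \<forall>n\<ge>M. norm (s m - s n) < e" by blast
  qed
  then obtain y where y: "s \<longlonglongrightarrow> y" using Cauchy_convergent convergent_def by blast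
  have yV: "y \<in> V" using V(2) s(1) y closed_sequentially by blast
  have lim_d: "(\<lambda>n. d + 1 / real (Suc n)) \<longlonglongrightarrow> d + 0"
    by (intro tendsto_add tendsto_const LIMSEQ_Suc lim_inverse_n[unfolded inverse_eq_divide])
  have lim_y: "(\<lambda>n. (norm (x - s n))\<^sup>2) \<longlonglongrightarrow> (norm (x - y))\<^sup>2"
    by (intro tendsto_intros y)
  have yd: "(norm (x - y))\<^sup>2 \<le> d"
    using LIMSEQ_le[OF lim_y lim_d] s(2) less_imp_le by auto
  have "inner (x - y) v = 0" if "v \<in> V" for v
  proof (cases "v = 0")
    case False
    \<comment> \<open>The real number that minimizes the squared distance from \<open>x\<close> to
      \<open>y + t *\<^sub>R v\<close>; comparison with \<open>t = 0\<close> forces the inner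
      product to vanish.\<close>
    define t where "t = inner (x - y) v / inner v v"
    have "y + t *\<^sub>R v \<in> V" using yV that V(1) by (simp add: subspace_add subspace_scale)
    then have "(norm (x - y))\<^sup>2 \<le> (norm (x - y - t *\<^sub>R v))\<^sup>2"
      using d_le yd by (metis diff_diff_add order_trans)
    also have "\<dots> = (norm (x - y))\<^sup>2 - 2 * t * inner (x - y) v + t * t * inner v v"
      by (simp add: power2_norm_eq_inner inner_diff_left inner_diff_right inner_commute algebra_simps)
    also have "\<dots> = (norm (x - y))\<^sup>2 - (inner (x - y) v)\<^sup>2 / inner v v"
      using False by (simp add: t_def power2_eq_square)
    finally have "(inner (x - y) v)\<^sup>2 / inner v v \<le> 0" by simp
    moreover have "inner v v > 0" using False by simp
    ultimately show ?thesis by (simp add: divide_le_0_iff)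
  qed auto
  with yV show ?thesis by blast
qed

definition proj :: "'a::real_inner set \<Rightarrow> 'a \<Rightarrow> 'a" where
  "proj V x = (SOME y. y \<in> V \<and> (\<forall>v\<in>V. inner (x - y) v = 0))"

locale closed_subspace =
  fixes V :: "'a::{real_inner, complete_space} set"
  assumes subspace: "subspace V" and closed: "closed V"
begin

lemma proj_in: "proj V x \<in> V"
  and proj_orth: "v \<in> V \<Longrightarrow> inner (x - proj V x) v = 0"
proof -
  have "proj V x \<in> V \<and> (\<forall>v\<in>V. inner (x - proj V x) v = 0)"
    unfolding proj_def using ex_orthogonal_projection[OF subspace closed] by (rule someI2_bex) blast
  then show "proj V x \<in> V" "v \<in> V \<Longrightarrow> inner (x - proj V x) v = 0" by auto
qed

lemma proj_unique:
  assumes "y \<in> V" "\<And>v. v \<in> V \<Longrightarrow> inner (x - y) v = 0"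
  shows "proj V x = y"
proof -
  have "inner (proj V x - y) (proj V x - y) = inner (x - y) (proj V x - y) - inner (x - proj V x) (proj V x - y)"
    by (simp add: inner_diff_left)
  also have "\<dots> = 0"
    using assms proj_in proj_orth subspace by (simp add: subspace_diff)
  finally show ?thesis by simp
qed

lemma proj_id: "x \<in> V \<Longrightarrow> proj V x = x"
  by (rule proj_unique) auto

lemma inner_proj: "inner (proj V x) y = inner x (proj V y)"
  using proj_orth[OF proj_in, of x y] proj_orth[OF proj_in, of y x]
  by (simp add: inner_diff_left inner_diff_right inner_commute)

lemma proj_add: "proj V (x + y) = proj V x + proj V y"
  by (rule proj_unique)
    (auto simp: proj_in subspace subspace_add proj_orth add_diff_add inner_add_left)

lemma proj_scaleR: "proj V (r *\<^sub>R x) = r *\<^sub>R proj V x"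
  by (rule proj_unique)
    (auto simp: proj_in subspace subspace_scale proj_orth simp flip: scaleR_diff_right)

lemma norm_proj_le: "norm (proj V x) \<le> norm x"
proof -
  have "(norm (proj V x))\<^sup>2 = inner x (proj V x)"
    using proj_orth[OF proj_in, of x x] by (simp add: power2_norm_eq_inner inner_diff_left)
  also have "\<dots> \<le> norm x * norm (proj V x)" by (rule norm_cauchy_schwarz)
  finally show ?thesis
    by (cases "proj V x = 0") (auto simp: power2_eq_square)
qed

lemma bounded_linear_proj: "bounded_linear (proj V)"
  by (rule bounded_linear_intro[of _ 1]) (auto simp: proj_add proj_scaleR norm_proj_le)

text \<open>Invariance of \<open>V\<close> under the adjoint makes the orthogonal complement
  invariant under \<open>T\<close>, so \<open>T\<close> respects the decomposition of each
  vector.\<close>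

lemma proj_commute:
  assumes T: "linear T" and adj: "\<And>x y. inner (T x) y = inner x (T' y)"
    and inv: "\<And>x. x \<in> V \<Longrightarrow> T x \<in> V" "\<And>x. x \<in> V \<Longrightarrow> T' x \<in> V"
  shows "proj V (T x) = T (proj V x)"
proof (rule proj_unique)
  show "T (proj V x) \<in> V" by (simp add: inv proj_in)
  fix v assume "v \<in> V"
  then show "inner (T x - T (proj V x)) v = 0"
    using adj[of "x - proj V x" v] by (simp add: linear_diff[OF T] proj_orth inv)
qed


end

lemma riesz:
  fixes f :: "'a::{real_inner, complete_space} \<Rightarrow> real"
  assumes "bounded_linear f"
  shows "\<exists>z. \<forall>x. f x = inner x z"
proof (cases "\<forall>x. f x = 0")
  case True
  then show ?thesis by (intro exI[of _ 0]) simp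
next
  case False
  then obtain u where u: "f u \<noteq> 0" by blast
  interpret f: bounded_linear f by fact
  interpret K: closed_subspace "{x. f x = 0}"
    by standard (auto simp: subspace_def f.add f.scaleR intro!: closed_Collect_eq f.continuous_on continuous_intros)
  define w where "w = u - proj {x. f x = 0} u"
  have fw: "f w = f u" using K.proj_in[of u] by (simp add: w_def f.diff)
  have "f x = inner x ((f u / inner w w) *\<^sub>R w)" for x
  proof -
    have "x - (f x / f u) *\<^sub>R w \<in> {x. f x = 0}"
      by (simp add: f.diff f.scaleR fw u)
    then have "inner w (x - (f x / f u) *\<^sub>R w) = 0"
      unfolding w_def by (rule K.proj_orth)
    then have "inner x w = f x / f u * inner w w"
      by (simp add: inner_diff_right inner_commute)
    moreover have "w \<noteq> 0" using fw u f.zero by auto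
    ultimately show ?thesis using u by (simp add: field_simps)
  qed
  then show ?thesis by blast
qed

lemma ex_hilbert_adjoint:
  fixes T :: "'a::{real_inner, complete_space} \<Rightarrow> 'a"
  assumes "bounded_linear T"
  shows "\<exists>T'. bounded_linear T' \<and> (\<forall>x y. inner (T x) y = inner x (T' y))"
proof -
  interpret bounded_linear T by fact
  have "\<exists>z. \<forall>x. inner (T x) y = inner x z" for y
    by (rule riesz) (rule bounded_linear_compose[OF bounded_linear_inner_left assms])
  then obtain T' where T': "\<And>x y. inner (T x) y = inner x (T' y)" by metis
  obtain K where K: "\<And>x. norm (T x) \<le> norm x * K" "K \<ge> 0" using nonneg_bounded by blast
  have eqI: "a = b" if "\<And>x. inner x a = inner x b" for a b :: 'a
    using that[of "a - b"] by (metis inner_diff_right inner_eq_zero_iff right_minus_eq)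
  have "bounded_linear T'"
  proof (rule bounded_linear_intro)
    show "T' (x + y) = T' x + T' y" for x y
      by (rule eqI) (simp add: inner_add_right flip: T')
    show "T' (r *\<^sub>R x) = r *\<^sub>R T' x" for r x
      by (rule eqI) (simp flip: T')
    show "norm (T' x) \<le> norm x * K" for x
    proof -
      have "(norm (T' x))\<^sup>2 = inner (T (T' x)) x" by (simp add: T' power2_norm_eq_inner)
      also have "\<dots> \<le> norm (T (T' x)) * norm x" by (rule norm_cauchy_schwarz)
      also have "\<dots> \<le> (norm (T' x) * K) * norm x" by (intro mult_right_mono K) auto
      finally show ?thesis
        using K(2) by (cases "T' x = 0") (auto simp: power2_eq_square algebra_simps)
    qed
  qed
  with T' show ?thesis by blast
qed


text \<open>Lets real orthogonality, the only kind that \<open>proj\<close> knows, yield complex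
  orthogonality whenever the subspace is closed under multiplication by \<i>.\<close>

lemma cip_inner: "cip \<xi> \<eta> = Complex (inner \<xi> \<eta>) (inner \<xi> (cscale \<i> \<eta>))"
proof -
  have "cip \<xi> (cscale \<i> \<eta>) = - \<i> * cip \<xi> \<eta>"
    by (metis cip_cnj cip_cscale_left complex_cnj_i complex_cnj_mult)
  then show ?thesis by (simp add: inner_l2_def complex_eq_iff)
qed

lemma cscale_add: "cscale c (\<xi> + \<eta>) = cscale c \<xi> + cscale c \<eta>"
  by (rule l2_eqI) (simp add: distrib_left)

lemma cscale_cscale: "cscale c (cscale d \<xi>) = cscale (c * d) \<xi>"
  by (rule l2_eqI) simp

lemma cip_add_right: "cip \<xi> (\<eta> + \<eta>') = cip \<xi> \<eta> + cip \<xi> \<eta>'"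
  by (metis cip_add_left cip_cnj complex_cnj_add)

lemma cip_cscale_right: "cip \<xi> (cscale c \<eta>) = cnj c * cip \<xi> \<eta>"
  by (metis cip_cnj cip_cscale_left complex_cnj_mult)

lemma cip_cauchy_schwarz: "cmod (cip \<xi> \<eta>) \<le> norm \<xi> * norm \<eta>"
proof -
  \<comment> \<open>This phase turns the inner product into its modulus and so reduces the claim to
    the real inequality; it is 0 when the inner product is 0.\<close>
  define c where "c = cnj (sgn (cip \<xi> \<eta>))"
  have "cip (cscale c \<xi>) \<eta> = of_real (cmod (cip \<xi> \<eta>))"
    by (simp add: cip_cscale_left c_def sgn_eq mult.commute[of "cnj _"] complex_norm_square[symmetric]
        power2_eq_square)
  then have "cmod (cip \<xi> \<eta>) = inner (cscale c \<xi>) \<eta>" by (simp add: inner_l2_def)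
  also have "\<dots> \<le> norm (cscale c \<xi>) * norm \<eta>" by (rule norm_cauchy_schwarz)
  also have "\<dots> \<le> 1 * norm \<xi> * norm \<eta>"
    unfolding norm_cscale by (intro mult_right_mono) (auto simp: c_def norm_sgn)
  finally show ?thesis by simp
qed

lemma bounded_linear_cscale: "bounded_linear (cscale c)"
  by (rule bounded_linear_intro[of _ "cmod c"])
    (auto intro!: l2_eqI simp: distrib_left mult.left_commute scaleR_cscale)

lemma bounded_linear_cip_left: "bounded_linear (\<lambda>\<xi>. cip \<xi> \<eta>)"
  by (rule bounded_linear_intro[of _ "norm \<eta>"])
    (auto simp: cip_add_left scaleR_cscale cip_cscale_left scaleR_conv_of_real cip_cauchy_schwarz)

lemma bounded_linear_cip_right: "bounded_linear (\<lambda>\<eta>. cip \<xi> \<eta>)"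
  by (rule bounded_linear_intro[of _ "norm \<xi>"])
    (auto simp: cip_add_right scaleR_cscale cip_cscale_right scaleR_conv_of_real
      intro: order_trans[OF cip_cauchy_schwarz])

lemmas cip_diff_left = linear_diff[OF bounded_linear.linear[OF bounded_linear_cip_left]]
  and cip_sum_left = linear_sum[OF bounded_linear.linear[OF bounded_linear_cip_left]]
  and cip_sum_right = linear_sum[OF bounded_linear.linear[OF bounded_linear_cip_right]]
  and cip_zero_right [simp] = linear_0[OF bounded_linear.linear[OF bounded_linear_cip_right]]

lemma inner_cscale_left: "inner (cscale c \<xi>) \<eta> = inner \<xi> (cscale (cnj c) \<eta>)"
  by (simp add: inner_l2_def cip_cscale_left cip_cscale_right)

section \<open>Basis vectors and bounded complex-linear operators\<close>

definition ket :: "'a \<Rightarrow> 'a l2" where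
  "ket x = l2_of (\<lambda>y. if y = x then 1 else 0)"

lemma coord_ket: "coord (ket x) y = (if y = x then 1 else 0)"
proof -
  have "(\<lambda>y. (cmod (if y = x then 1 else 0))\<^sup>2) summable_on UNIV"
    by (subst summable_on_cong_neutral[where T = "{x}" and g = "\<lambda>_. 1"]) auto
  then show ?thesis by (simp add: ket_def l2_of_inverse ell2_UNIV)
qed

lemma cip_ket_right [simp]: "cip \<xi> (ket x) = coord \<xi> x"
  unfolding cip_def coord_ket
  by (subst infsum_cong_neutral[where T = "{x}" and g = "\<lambda>_. coord \<xi> x"]) auto

lemma cip_ket_left [simp]: "cip (ket x) \<xi> = cnj (coord \<xi> x)"
  by (metis cip_cnj cip_ket_right)

definition bounded_clinear :: "('a l2 \<Rightarrow> 'b l2) \<Rightarrow> bool" where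
  "bounded_clinear T \<longleftrightarrow> bounded_linear T \<and> (\<forall>c \<xi>. T (cscale c \<xi>) = cscale c (T \<xi>))"

lemma bounded_clinearD:
  assumes "bounded_clinear T"
  shows "bounded_linear T" "T (cscale c \<xi>) = cscale c (T \<xi>)"
    "T (\<xi> + \<eta>) = T \<xi> + T \<eta>" "T (\<xi> - \<eta>) = T \<xi> - T \<eta>" "T (sum f A) = (\<Sum>i\<in>A. T (f i))"
  using assms linear_sum[of T f A] unfolding bounded_clinear_def
  by (auto simp: linear_add linear_diff bounded_linear.linear)

lemma bounded_clinear_id: "bounded_clinear (\<lambda>\<xi>. \<xi>)"
  by (simp add: bounded_clinear_def bounded_linear_ident)

lemma bounded_clinear_add:
  "bounded_clinear T \<Longrightarrow> bounded_clinear U \<Longrightarrow> bounded_clinear (\<lambda>\<xi>. T \<xi> + U \<xi>)"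
  by (simp add: bounded_clinear_def bounded_linear_add cscale_add)

lemma bounded_clinear_compose:
  "bounded_clinear T \<Longrightarrow> bounded_clinear U \<Longrightarrow> bounded_clinear (\<lambda>\<xi>. T (U \<xi>))"
  by (auto simp: bounded_clinear_def intro: bounded_linear_compose)

lemma bounded_clinear_cscale: "bounded_clinear (cscale c)"
  by (simp add: bounded_clinear_def bounded_linear_cscale cscale_cscale mult.commute)

definition hadj :: "('a l2 \<Rightarrow> 'a l2) \<Rightarrow> 'a l2 \<Rightarrow> 'a l2" where
  "hadj T = (SOME T'. bounded_linear T' \<and> (\<forall>\<xi> \<eta>. inner (T \<xi>) \<eta> = inner \<xi> (T' \<eta>)))"

lemma cip_left_eqI:
  fixes \<eta> \<eta>' :: "'a l2"
  assumes "\<And>\<xi>. cip \<xi> \<eta> = cip \<xi> \<eta>'"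
  shows "\<eta> = \<eta>'"
  using assms[of "ket _"] by (intro l2_eqI) simp

text \<open>The adjoint supplied by the real theory is also the complex one: complex linearity lets
  the factor \<i> be carried past \<open>T\<close>, and \<open>cip_inner\<close> reads the imaginary
  part off from that.\<close>

lemma cip_eq_of_inner:
  assumes "bounded_clinear T" "\<And>\<xi> \<eta>. inner (T \<xi>) \<eta> = inner \<xi> (T' \<eta>)"
  shows "cip (T \<xi>) \<eta> = cip \<xi> (T' \<eta>)"
proof -
  have "inner (T \<xi>) (cscale \<i> \<eta>) = inner \<xi> (cscale \<i> (T' \<eta>))"
    using inner_cscale_left[of "-\<i>" "T \<xi>" \<eta>] inner_cscale_left[of "-\<i>" \<xi> "T' \<eta>"]
      assms(2)[of "cscale (-\<i>) \<xi>" \<eta>] bounded_clinearD(2)[OF assms(1)] by simp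
  then show ?thesis by (simp add: cip_inner assms(2))
qed

lemma hadj:
  assumes "bounded_clinear T"
  shows bounded_clinear_hadj: "bounded_clinear (hadj T)"
    and cip_hadj: "cip (T \<xi>) \<eta> = cip \<xi> (hadj T \<eta>)"
proof -
  have *: "bounded_linear (hadj T) \<and> (\<forall>\<xi> \<eta>. inner (T \<xi>) \<eta> = inner \<xi> (hadj T \<eta>))"
    using someI_ex[OF ex_hilbert_adjoint[OF bounded_clinearD(1)[OF assms]]]
    unfolding hadj_def .
  then have cip: "cip (T \<xi>) \<eta> = cip \<xi> (hadj T \<eta>)" for \<xi> \<eta>
    by (intro cip_eq_of_inner assms) auto
  then show "cip (T \<xi>) \<eta> = cip \<xi> (hadj T \<eta>)" .
  have "hadj T (cscale c \<eta>) = cscale c (hadj T \<eta>)" for c \<eta>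
    by (rule cip_left_eqI) (simp add: cip_cscale_right flip: cip)
  with * show "bounded_clinear (hadj T)" by (simp add: bounded_clinear_def)
qed

lemma cip_hadj': "bounded_clinear T \<Longrightarrow> cip (hadj T \<xi>) \<eta> = cip \<xi> (T \<eta>)"
  by (metis cip_cnj cip_hadj)

lemma hadj_unique:
  assumes "bounded_clinear T" "\<And>\<xi> \<eta>. cip (T \<xi>) \<eta> = cip \<xi> (T' \<eta>)"
  shows "hadj T = T'"
  by (intro ext cip_left_eqI) (metis assms cip_hadj)

text \<open>In place of a density argument the adjoints are compared: each coordinate of
  \<open>hadj T \<eta>\<close> is determined by the value of \<open>T\<close> at one basis
  vector.\<close>

lemma bounded_clinear_eqI:
  fixes T U :: "'a l2 \<Rightarrow> 'a l2"
  assumes "bounded_clinear T" "bounded_clinear U" "\<And>x. T (ket x) = U (ket x)"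
  shows "T = U"
proof -
  have "hadj T \<eta> = hadj U \<eta>" for \<eta>
  proof (rule l2_eqI)
    fix x
    have "cip (ket x) (hadj T \<eta>) = cip (ket x) (hadj U \<eta>)"
      using assms by (simp flip: cip_hadj del: cip_ket_left)
    then show "coord (hadj T \<eta>) x = coord (hadj U \<eta>) x" by simp
  qed
  then have "cip \<xi> (T \<eta>) = cip \<xi> (U \<eta>)" for \<xi> \<eta>
    using assms by (metis cip_hadj')
  then show ?thesis by (intro ext cip_left_eqI)
qed


section \<open>Operators on l2\<close>

text \<open>Dictionary between maps on the type \<open>l2\<close> and the extensional functions in
  which von Neumann algebras are stated; it matches \<open>bounded_clinear\<close> maps with
  \<open>bounded_operators UNIV\<close>, and each algebraic operation with its pointwise
  form.\<close>

definition fun_op :: "('a l2 \<Rightarrow> 'a l2) \<Rightarrow> 'a operator" where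
  "fun_op T = (\<lambda>\<xi>\<in>ell2 UNIV. coord (T (l2_of \<xi>)))"

definition l2_op :: "'a operator \<Rightarrow> 'a l2 \<Rightarrow> 'a l2" where
  "l2_op A \<xi> = l2_of (A (coord \<xi>))"

lemma coord_ell2 [simp]: "coord \<xi> \<in> ell2 UNIV"
  by (rule coord)

lemma fun_op_coord [simp]: "fun_op T (coord \<xi>) = coord (T \<xi>)"
  by (simp add: fun_op_def coord_inverse)

lemma ell2_UNIV_cases:
  assumes "\<xi> \<in> ell2 UNIV" obtains \<xi>' where "\<xi> = coord \<xi>'"
  using assms l2_of_inverse by metis

lemma ball_ell2_UNIV: "(\<forall>\<xi>\<in>ell2 UNIV. P \<xi>) \<longleftrightarrow> (\<forall>\<xi>. P (coord \<xi>))"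
  by (metis coord_ell2 ell2_UNIV_cases)

lemma coord_add_fun: "(\<lambda>x. coord \<xi> x + coord \<eta> x) = coord (\<xi> + \<eta>)"
  and coord_cscale_fun: "(\<lambda>x. c * coord \<xi> x) = coord (cscale c \<xi>)"
  by auto

lemma ell2_inner_coord: "ell2_inner UNIV (coord \<xi>) (coord \<eta>) = cip \<xi> \<eta>"
  by (simp add: ell2_inner_def cip_def)

lemma fun_op_extensional: "fun_op T \<in> extensional (ell2 UNIV)"
  by (simp add: fun_op_def)

lemma operator_eqI:
  assumes "A \<in> extensional (ell2 UNIV)" "B \<in> extensional (ell2 UNIV)"
    "\<And>\<xi>. A (coord \<xi>) = B (coord \<xi>)"
  shows "A = B"
  using assms by (intro extensionalityI[of _ "ell2 UNIV"]) (auto elim: ell2_UNIV_cases)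

lemma fun_op_inject: "fun_op T = fun_op U \<longleftrightarrow> T = U"
  by (metis coord_inject ext fun_op_coord)

lemma fun_op_bounded:
  assumes "bounded_clinear T"
  shows "fun_op T \<in> bounded_operators UNIV"
proof -
  obtain K where "\<And>\<xi>. norm (T \<xi>) \<le> norm \<xi> * K"
    using bounded_linear.bounded[OF bounded_clinearD(1)[OF assms]] by blast
  then have "\<exists>C. \<forall>\<xi>. norm (T \<xi>) \<le> C * norm \<xi>" by (metis mult.commute)
  moreover have "fun_op T \<in> ell2 UNIV \<rightarrow>\<^sub>E ell2 UNIV"
    by (auto simp: fun_op_def)
  ultimately show ?thesis
    unfolding bounded_operators_def mem_Collect_eq ball_ell2_UNIV fun_op_coord coord_add_fun
      coord_cscale_fun norm_l2_ell2[symmetric] bounded_clinearD[OF assms] by simp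
qed

lemma bounded_operators_cases:
  assumes "A \<in> bounded_operators UNIV"
  obtains T where "bounded_clinear T" "A = fun_op T"
proof
  have A: "A (coord \<xi>) \<in> ell2 UNIV" for \<xi>
    using assms by (auto simp: bounded_operators_def)
  then have co: "coord (l2_op A \<xi>) = A (coord \<xi>)" for \<xi>
    by (simp add: l2_op_def l2_of_inverse)
  have A': "A (coord (\<xi> + \<eta>)) = (\<lambda>x. A (coord \<xi>) x + A (coord \<eta>) x)"
    "A (coord (cscale c \<xi>)) = (\<lambda>x. c * A (coord \<xi>) x)" for \<xi> \<eta> c
    using assms unfolding bounded_operators_def mem_Collect_eq ball_ell2_UNIV coord_add_fun
      coord_cscale_fun by auto
  obtain C where "\<And>\<xi>. norm (l2_op A \<xi>) \<le> C * norm \<xi>"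
    using assms unfolding bounded_operators_def mem_Collect_eq ball_ell2_UNIV norm_l2_ell2 co by auto
  then have C: "norm (l2_op A \<xi>) \<le> norm \<xi> * C" for \<xi> by (simp add: mult.commute)
  have scale: "l2_op A (cscale c \<xi>) = cscale c (l2_op A \<xi>)" for c \<xi>
    by (rule l2_eqI) (simp add: co A')
  have "bounded_linear (l2_op A)"
  proof (rule bounded_linear_intro[of _ C])
    show "l2_op A (\<xi> + \<eta>) = l2_op A \<xi> + l2_op A \<eta>" for \<xi> \<eta>
      by (rule l2_eqI) (simp add: co A')
  qed (auto simp: scaleR_cscale scale C)
  with scale show "bounded_clinear (l2_op A)" by (simp add: bounded_clinear_def)
  show "A = fun_op (l2_op A)"
    using assms by (intro operator_eqI fun_op_extensional) (auto simp: bounded_operators_def co PiE_iff)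
qed

lemma fun_op_bounded_iff: "fun_op T \<in> bounded_operators UNIV \<longleftrightarrow> bounded_clinear T"
  by (metis bounded_operators_cases fun_op_bounded fun_op_inject)

lemma op_id_fun_op: "op_id UNIV = fun_op (\<lambda>\<xi>. \<xi>)"
  by (rule operator_eqI) (auto simp: op_id_def fun_op_extensional)

lemma op_add_fun_op: "op_add UNIV (fun_op T) (fun_op U) = fun_op (\<lambda>\<xi>. T \<xi> + U \<xi>)"
  by (rule operator_eqI) (auto simp: op_add_def fun_op_extensional)

lemma op_scale_fun_op: "op_scale UNIV c (fun_op T) = fun_op (\<lambda>\<xi>. cscale c (T \<xi>))"
  by (rule operator_eqI) (auto simp: op_scale_def fun_op_extensional)

lemma op_mult_fun_op: "op_mult UNIV (fun_op T) (fun_op U) = fun_op (\<lambda>\<xi>. T (U \<xi>))"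
  by (rule operator_eqI) (auto simp: op_mult_def fun_op_extensional compose_def)

lemma op_adjoint_fun_op:
  assumes "bounded_clinear T"
  shows "op_adjoint UNIV (fun_op T) = fun_op (hadj T)"
  unfolding op_adjoint_def
proof (rule the_equality)
  show "fun_op (hadj T) \<in> bounded_operators UNIV \<and> (\<forall>\<xi>\<in>ell2 UNIV. \<forall>\<eta>\<in>ell2 UNIV.
      ell2_inner UNIV (fun_op T \<xi>) \<eta> = ell2_inner UNIV \<xi> (fun_op (hadj T) \<eta>))"
    by (simp add: ball_ell2_UNIV ell2_inner_coord cip_hadj assms fun_op_bounded bounded_clinear_hadj)
  fix U assume U: "U \<in> bounded_operators UNIV \<and> (\<forall>\<xi>\<in>ell2 UNIV. \<forall>\<eta>\<in>ell2 UNIV.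
      ell2_inner UNIV (fun_op T \<xi>) \<eta> = ell2_inner UNIV \<xi> (U \<eta>))"
  then obtain U' where U': "U = fun_op U'" using bounded_operators_cases by blast
  have "cip (T \<xi>) \<eta> = cip \<xi> (U' \<eta>)" for \<xi> \<eta>
    using conjunct2[OF U] unfolding ball_ell2_UNIV U' fun_op_coord ell2_inner_coord by blast
  then show "U = fun_op (hadj T)" unfolding U' by (simp add: hadj_unique[OF assms])
qed

section \<open>Weak closedness in terms of finitely many matrix coefficients\<close>

lemma topspace_wot: "topspace (weak_operator_topology S) = bounded_operators S"
  by (auto simp: weak_operator_topology_def topspace_pullback_topology)

lemma wot_continuous_coefficient:
  assumes "\<xi> \<in> ell2 S" "\<eta> \<in> ell2 S"
  shows "continuous_map (weak_operator_topology S) euclidean (\<lambda>T. ell2_inner S (T \<xi>) \<eta>)"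
proof -
  have "continuous_map (weak_operator_topology S) euclidean
     ((\<lambda>f. f (\<xi>, \<eta>)) \<circ> (\<lambda>T. \<lambda>(\<xi>, \<eta>)\<in>ell2 S \<times> ell2 S. ell2_inner S (T \<xi>) \<eta>))"
    unfolding weak_operator_topology_def
    by (rule continuous_map_pullback)
      (use continuous_map_product_projection[of "(\<xi>, \<eta>)" "ell2 S \<times> ell2 S" "\<lambda>_. euclidean"] assms in auto)
  then show ?thesis using assms by (simp add: comp_def)
qed

lemma wot_closedD:
  assumes M: "closedin (weak_operator_topology S) M"
    and T: "T \<in> bounded_operators S"
    and near: "\<And>F e. finite F \<Longrightarrow> F \<subseteq> ell2 S \<times> ell2 S \<Longrightarrow> 0 < e \<Longrightarrow>
      \<exists>U\<in>M. \<forall>(\<xi>, \<eta>)\<in>F. cmod (ell2_inner S (T \<xi>) \<eta> - ell2_inner S (U \<xi>) \<eta>) < e"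
  shows "T \<in> M"
proof (rule ccontr)
  assume "T \<notin> M"
  let ?I = "ell2 S \<times> ell2 S"
  define f where "f = (\<lambda>T. \<lambda>(\<xi>, \<eta>)\<in>?I. ell2_inner S (T \<xi>) \<eta>)"
  have "openin (weak_operator_topology S) (bounded_operators S - M)"
    using M by (metis closedin_def topspace_wot)
  then obtain U where U: "openin (product_topology (\<lambda>_. euclidean) ?I) U"
      "bounded_operators S - M = f -` U \<inter> bounded_operators S"
    unfolding weak_operator_topology_def openin_pullback_topology f_def by blast
  with T \<open>T \<notin> M\<close> have "f T \<in> U" by blast
  then obtain V where V: "finite {i \<in> ?I. V i \<noteq> UNIV}" "\<forall>i\<in>?I. open (V i)"
      "f T \<in> Pi\<^sub>E ?I V" "Pi\<^sub>E ?I V \<subseteq> U"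
    using bspec[OF iffD1[OF openin_product_topology_alt U(1)] \<open>f T \<in> U\<close>]
    unfolding topspace_euclidean open_openin[symmetric] by (elim exE conjE)
  define F where "F = {i \<in> ?I. V i \<noteq> UNIV}"
  have "\<exists>e>0. ball (f T i) e \<subseteq> V i" if "i \<in> ?I" for i
    using V(2,3) that by (intro open_contains_ball[THEN iffD1, rule_format]) (auto simp: PiE_iff)
  then obtain r where r: "\<And>i. i \<in> ?I \<Longrightarrow> 0 < r i" "\<And>i. i \<in> ?I \<Longrightarrow> ball (f T i) (r i) \<subseteq> V i"
    by metis
  \<comment> \<open>The 1 keeps \<open>Min\<close> meaningful when the open box constrains no
    coefficient.\<close>
  define e where "e = Min (insert 1 (r ` F))"
  have F: "finite F" "F \<subseteq> ?I" using V(1) by (auto simp: F_def)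
  then have "0 < e" and e_le: "\<And>i. i \<in> F \<Longrightarrow> e \<le> r i"
    using r(1) by (auto simp: e_def)
  then obtain W where W: "W \<in> M" "\<forall>(\<xi>, \<eta>)\<in>F. cmod (ell2_inner S (T \<xi>) \<eta> - ell2_inner S (W \<xi>) \<eta>) < e"
    using near F by blast
  have "f W i \<in> V i" if "i \<in> ?I" for i
  proof (cases "i \<in> F")
    case True
    then have "f W i \<in> ball (f T i) (r i)"
      using W(2) e_le[OF True] that by (force simp: f_def dist_norm split: prod.splits)
    then show ?thesis using r(2) that by blast
  next
    case False
    then show ?thesis using that by (auto simp: F_def)
  qed
  moreover have "f W \<in> extensional ?I" by (simp add: f_def)
  ultimately have "f W \<in> Pi\<^sub>E ?I V" by (simp add: PiE_iff del: mem_Sigma_iff)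
  then have "f W \<in> U" using V(4) by blast
  moreover have "W \<in> bounded_operators S"
    using M W(1) closedin_subset topspace_wot by blast
  ultimately show False using U(2) W(1) by blast
qed

section \<open>The double commutant\<close>

text \<open>The \<open>i\<close>-th summand of a direct sum of copies of the space. The summands are
  indexed by the second component, so that the sum is an \<open>l2\<close> space again;
  \<open>amp_out i\<close> is the adjoint of this embedding.\<close>

definition amp_in :: "'i \<Rightarrow> 'a l2 \<Rightarrow> ('a \<times> 'i) l2" where
  "amp_in i \<xi> = l2_of (\<lambda>(x, j). if j = i then coord \<xi> x else 0)"

definition amp_out :: "'i \<Rightarrow> ('a \<times> 'i) l2 \<Rightarrow> 'a l2" where
  "amp_out i \<Xi> = l2_of (\<lambda>x. coord \<Xi> (x, i))"

lemma has_sum_amp: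
  fixes f :: "'a \<times> 'i \<Rightarrow> 'c::{comm_monoid_add, topological_space}"
  assumes "\<And>x j. j \<noteq> i \<Longrightarrow> f (x, j) = 0"
  shows "(f has_sum s) UNIV \<longleftrightarrow> ((\<lambda>x. f (x, i)) has_sum s) UNIV"
proof -
  have "(f has_sum s) UNIV \<longleftrightarrow> (f has_sum s) (range (\<lambda>x. (x, i)))"
    by (rule has_sum_cong_neutral) (use assms in auto)
  also have "\<dots> \<longleftrightarrow> ((f \<circ> (\<lambda>x. (x, i))) has_sum s) UNIV"
    by (rule has_sum_reindex) (auto simp: inj_on_def)
  finally show ?thesis by (simp add: comp_def)
qed

lemma coord_amp_in: "coord (amp_in i \<xi>) (x, j) = (if j = i then coord \<xi> x else 0)"
proof -
  have "(\<lambda>(x, j). if j = i then coord \<xi> x else 0) \<in> ell2 UNIV"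
    unfolding ell2_UNIV summable_on_def
    by (subst has_sum_amp[where i = i]) (use summable_coord[of \<xi>] in \<open>auto simp: summable_on_def\<close>)
  then show ?thesis by (simp add: amp_in_def l2_of_inverse)
qed

lemma coord_amp_out: "coord (amp_out i \<Xi>) x = coord \<Xi> (x, i)"
proof -
  have "(\<lambda>y. (cmod (coord \<Xi> y))\<^sup>2) summable_on range (\<lambda>x. (x, i))"
    using summable_coord by (rule summable_on_subset_banach) auto
  then have "(\<lambda>x. (cmod (coord \<Xi> (x, i)))\<^sup>2) summable_on UNIV"
    by (subst (asm) summable_on_reindex) (auto simp: inj_on_def comp_def)
  then show ?thesis by (simp add: amp_out_def l2_of_inverse ell2_UNIV)
qed

lemma cip_amp: "cip (amp_in i \<xi>) \<Xi> = cip \<xi> (amp_out i \<Xi>)"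
proof -
  have "((\<lambda>y. coord (amp_in i \<xi>) y * cnj (coord \<Xi> y)) has_sum cip (amp_in i \<xi>) \<Xi>) UNIV"
    by (simp add: cip_def summable_cip)
  then have "((\<lambda>x. coord \<xi> x * cnj (coord (amp_out i \<Xi>) x)) has_sum cip (amp_in i \<xi>) \<Xi>) UNIV"
    by (subst (asm) has_sum_amp[where i = i]) (auto simp: coord_amp_in coord_amp_out)
  then show ?thesis by (simp add: cip_def infsumI)
qed

lemma amp_out_in: "amp_out j (amp_in i \<xi>) = (if i = j then \<xi> else 0)"
  by (rule l2_eqI) (auto simp: coord_amp_in coord_amp_out)

lemma norm_amp_in [simp]: "norm (amp_in i \<xi>) = norm \<xi>"
  by (simp add: norm_l2_def inner_l2_def cip_amp amp_out_in)

lemma norm_amp_out_le: "norm (amp_out i \<Xi>) \<le> norm \<Xi>"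
proof -
  have "(norm (amp_out i \<Xi>))\<^sup>2 = inner (amp_in i (amp_out i \<Xi>)) \<Xi>"
    by (simp add: power2_norm_eq_inner inner_l2_def cip_amp)
  also have "\<dots> \<le> norm (amp_out i \<Xi>) * norm \<Xi>"
    using norm_cauchy_schwarz[of "amp_in i (amp_out i \<Xi>)" \<Xi>] by simp
  finally show ?thesis
    by (cases "amp_out i \<Xi> = 0") (auto simp: power2_eq_square)
qed

lemma bounded_clinear_amp_in: "bounded_clinear (amp_in i)"
  unfolding bounded_clinear_def
  by (intro conjI allI bounded_linear_intro[of _ 1] l2_eqI)
    (auto simp: coord_amp_in split_paired_all scaleR_cscale)

lemma bounded_clinear_amp_out: "bounded_clinear (amp_out i)"
  unfolding bounded_clinear_def
  by (intro conjI allI bounded_linear_intro[of _ 1] l2_eqI)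
    (auto simp: coord_amp_out scaleR_cscale norm_amp_out_le)

definition csubspace :: "'a l2 set \<Rightarrow> bool" where
  "csubspace V \<longleftrightarrow> 0 \<in> V \<and> (\<forall>\<xi>\<in>V. \<forall>\<eta>\<in>V. \<xi> + \<eta> \<in> V) \<and> (\<forall>c. \<forall>\<xi>\<in>V. cscale c \<xi> \<in> V)"

lemma image_closure_subset_closure:
  assumes "bounded_linear T" "T ` A \<subseteq> B"
  shows "T ` closure A \<subseteq> closure B"
  using assms closure_subset[of B]
  by (intro image_closure_subset linear_continuous_on) (auto simp: subset_iff)

lemma closure_csubspace:
  assumes "csubspace V"
  shows "csubspace (closure V)"
  unfolding csubspace_def
proof (intro conjI ballI allI)
  show "0 \<in> closure V" using assms closure_subset by (auto simp: csubspace_def)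
  show "cscale c \<xi> \<in> closure V" if "\<xi> \<in> closure V" for c \<xi>
    using image_closure_subset_closure[OF bounded_linear_cscale[of c], of V V] assms that
    by (auto simp: csubspace_def)
  show "\<xi> + \<eta> \<in> closure V" if "\<xi> \<in> closure V" "\<eta> \<in> closure V" for \<xi> \<eta>
  proof -
    obtain f g where "\<And>n. f n \<in> V" "f \<longlonglongrightarrow> \<xi>" "\<And>n. g n \<in> V" "g \<longlonglongrightarrow> \<eta>"
      using \<open>\<xi> \<in> closure V\<close> \<open>\<eta> \<in> closure V\<close> by (auto simp: closure_sequential)
    then have "(\<lambda>n. f n + g n) \<longlonglongrightarrow> \<xi> + \<eta>" "\<And>n. f n + g n \<in> V"
      using assms by (auto intro: tendsto_add simp: csubspace_def)
    then show ?thesis unfolding closure_sequential by (intro exI[of _ "\<lambda>n. f n + g n"]) auto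
  qed
qed

lemma closed_subspace_closure:
  assumes "csubspace V"
  shows "closed_subspace (closure V)"
  using closure_csubspace[OF assms]
  by unfold_locales (auto simp: subspace_def csubspace_def scaleR_cscale)

lemma proj_intertwines:
  assumes V: "csubspace V" and T: "bounded_linear T"
    and adj: "\<And>\<xi> \<eta>. inner (T \<xi>) \<eta> = inner \<xi> (T' \<eta>)" and T': "bounded_linear T'"
    and inv: "T ` V \<subseteq> V" "T' ` V \<subseteq> V"
  shows "proj (closure V) (T \<xi>) = T (proj (closure V) \<xi>)"
proof -
  interpret closed_subspace "closure V" by (rule closed_subspace_closure[OF V])
  show ?thesis
    using image_closure_subset_closure[OF T inv(1)] image_closure_subset_closure[OF T' inv(2)]
    by (intro proj_commute[OF bounded_linear.linear[OF T] adj]) auto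
qed

lemma bounded_clinear_proj:
  assumes "csubspace V"
  shows "bounded_clinear (proj (closure V))"
  unfolding bounded_clinear_def
proof (intro conjI allI)
  interpret closed_subspace "closure V" by (rule closed_subspace_closure[OF assms])
  show "bounded_linear (proj (closure V))" by (rule bounded_linear_proj)
  show "proj (closure V) (cscale c \<xi>) = cscale c (proj (closure V) \<xi>)" for c \<xi>
    using assms
    by (intro proj_intertwines[where T' = "cscale (cnj c)"] bounded_linear_cscale)
      (auto simp: inner_cscale_left csubspace_def)
qed

section \<open>A von Neumann algebra as a set \<open>ops\<close> of maps on the type, and its double
  commutant\<close>

locale vn =
  fixes M :: "'a operator set"
  assumes vn: "von_neumann_algebra UNIV M"
begin

definition ops :: "('a l2 \<Rightarrow> 'a l2) set" where
  "ops = {T. fun_op T \<in> M}"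

lemma ops_iff: "T \<in> ops \<longleftrightarrow> fun_op T \<in> M"
  by (simp add: ops_def)

lemma ops_bounded: "T \<in> ops \<Longrightarrow> bounded_clinear T"
  using vn by (auto simp: ops_def von_neumann_algebra_def simp flip: fun_op_bounded_iff)

lemma M_cases:
  assumes "A \<in> M" obtains T where "T \<in> ops" "A = fun_op T"
  using assms vn unfolding ops_def von_neumann_algebra_def
  by (metis bounded_operators_cases mem_Collect_eq subsetD)

lemma ops_id: "(\<lambda>\<xi>. \<xi>) \<in> ops"
  using vn by (simp add: ops_def von_neumann_algebra_def op_id_fun_op)

lemma ops_add: "T \<in> ops \<Longrightarrow> U \<in> ops \<Longrightarrow> (\<lambda>\<xi>. T \<xi> + U \<xi>) \<in> ops"
  using vn by (simp add: ops_def von_neumann_algebra_def flip: op_add_fun_op)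

lemma ops_cscale: "T \<in> ops \<Longrightarrow> (\<lambda>\<xi>. cscale c (T \<xi>)) \<in> ops"
  using vn by (simp add: ops_def von_neumann_algebra_def flip: op_scale_fun_op)

lemma ops_mult: "T \<in> ops \<Longrightarrow> U \<in> ops \<Longrightarrow> (\<lambda>\<xi>. T (U \<xi>)) \<in> ops"
  using vn by (simp add: ops_def von_neumann_algebra_def flip: op_mult_fun_op)

lemma ops_hadj: "T \<in> ops \<Longrightarrow> hadj T \<in> ops"
  using vn ops_bounded by (simp add: ops_def von_neumann_algebra_def flip: op_adjoint_fun_op)

lemma ops_zero: "(\<lambda>\<xi>. 0) \<in> ops"
  using ops_cscale[OF ops_id, of 0] by (simp add: l2_eqI[of "cscale 0 _" 0])

lemma ops_closed:
  assumes T: "bounded_clinear T"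
    and near: "\<And>F e. finite F \<Longrightarrow> 0 < e \<Longrightarrow>
      \<exists>U\<in>ops. \<forall>(\<xi>, \<eta>)\<in>F. cmod (cip (T \<xi>) \<eta> - cip (U \<xi>) \<eta>) < e"
  shows "T \<in> ops"
  unfolding ops_def mem_Collect_eq
proof (rule wot_closedD)
  show "closedin (weak_operator_topology UNIV) M"
    using vn by (simp add: von_neumann_algebra_def)
  show "fun_op T \<in> bounded_operators UNIV" using T by (rule fun_op_bounded)
  fix F :: "(('a \<Rightarrow> complex) \<times> ('a \<Rightarrow> complex)) set" and e :: real
  assume F: "finite F" "F \<subseteq> ell2 UNIV \<times> ell2 UNIV" and "0 < e"
  define h where "h = map_prod (coord :: 'a l2 \<Rightarrow> _) (coord :: 'a l2 \<Rightarrow> _)"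
  define F' where "F' = map_prod l2_of l2_of ` F"
  have F': "F = h ` F'"
    using F(2) by (force simp: F'_def h_def image_image l2_of_inverse map_prod_def split: prod.splits)
  obtain U where U: "U \<in> ops" "\<forall>(\<xi>, \<eta>)\<in>F'. cmod (cip (T \<xi>) \<eta> - cip (U \<xi>) \<eta>) < e"
    using near[of F' e] F(1) \<open>0 < e\<close> by (auto simp: F'_def)
  then show "\<exists>W\<in>M. \<forall>(\<xi>, \<eta>)\<in>F. cmod (ell2_inner UNIV (fun_op T \<xi>) \<eta> - ell2_inner UNIV (W \<xi>) \<eta>) < e"
    unfolding F' h_def
    by (intro bexI[of _ "fun_op U"]) (force simp: ops_def ell2_inner_coord)+
qed

theorem double_commutant:
  assumes T: "bounded_clinear T"
    and comm: "\<And>A \<xi>. bounded_clinear A \<Longrightarrow> (\<And>S \<xi>. S \<in> ops \<Longrightarrow> A (S \<xi>) = S (A \<xi>)) \<Longrightarrow> A (T \<xi>) = T (A \<xi>)"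
  shows "T \<in> ops"
proof (rule ops_closed[OF T])
  fix F :: "('a l2 \<times> 'a l2) set" and e :: real
  assume F: "finite F" and e: "0 < e"
  \<comment> \<open>Amplification with one copy of the space for each pair in \<open>F\<close>: \<open>T\<close> commutes with the matrix
    entries \<open>q i j\<close> of the projection onto the closure of \<open>V\<close>, because these lie in the commutant.\<close>
  define amp where "amp S \<Xi> = (\<Sum>i\<in>F. amp_in i (S (amp_out i \<Xi>)))"
    for S :: "'a l2 \<Rightarrow> 'a l2" and \<Xi> :: "('a \<times> 'a l2 \<times> 'a l2) l2"
  define vec where "vec S = (\<Sum>i\<in>F. amp_in i (S (fst i)))" for S :: "'a l2 \<Rightarrow> 'a l2"
  define V where "V = vec ` ops"
  note lin = bounded_clinearD[OF bounded_clinear_amp_in] bounded_clinearD[OF bounded_clinear_amp_out]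
  have V: "csubspace V"
    unfolding csubspace_def
  proof (intro conjI ballI allI)
    show "0 \<in> V" unfolding V_def
      by (rule image_eqI[OF _ ops_zero]) (simp add: vec_def linear_0 lin bounded_linear.linear)
    fix \<xi> assume "\<xi> \<in> V"
    then obtain S where S: "S \<in> ops" "\<xi> = vec S" by (auto simp: V_def)
    show "cscale c \<xi> \<in> V" for c unfolding V_def S(2)
      by (rule image_eqI[OF _ ops_cscale[OF S(1), of c]])
        (simp add: vec_def lin bounded_clinearD(5)[OF bounded_clinear_cscale])
    fix \<eta> assume "\<eta> \<in> V"
    then obtain U where U: "U \<in> ops" "\<eta> = vec U" by (auto simp: V_def)
    show "\<xi> + \<eta> \<in> V" unfolding V_def S(2) U(2)
      by (rule image_eqI[OF _ ops_add[OF S(1) U(1)]]) (simp add: vec_def lin sum.distrib)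
  qed
  interpret closed_subspace "closure V" by (rule closed_subspace_closure[OF V])
  let ?Q = "proj (closure V)"
  have amp_lin: "bounded_linear (amp S)" if "bounded_clinear S" for S
    unfolding amp_def
    by (intro bounded_linear_sum bounded_linear_compose[OF lin(1)] bounded_linear_compose[OF bounded_clinearD(1)[OF that]] lin(6))
  have amp_adj: "inner (amp S \<Xi>) \<Theta> = inner \<Xi> (amp (hadj S) \<Theta>)" if "bounded_clinear S" for S \<Xi> \<Theta>
  proof -
    have "cip (amp_in i (S (amp_out i \<Xi>))) \<Theta> = cip \<Xi> (amp_in i (hadj S (amp_out i \<Theta>)))" for i
      by (metis cip_amp cip_cnj cip_hadj that)
    then show ?thesis by (simp add: inner_l2_def amp_def cip_sum_left cip_sum_right)
  qed
  have amp_vec: "amp S (vec U) = vec (\<lambda>\<xi>. S (U \<xi>))" for S U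
    unfolding amp_def vec_def lin by (intro sum.cong refl) (simp add: amp_out_in F if_distrib[of S] sum.delta)
  have Q_amp: "?Q (amp S \<Xi>) = amp S (?Q \<Xi>)" if "S \<in> ops" for S \<Xi>
    using that ops_bounded ops_hadj ops_mult
    by (intro proj_intertwines[OF V amp_lin amp_adj amp_lin]) (auto simp: V_def amp_vec)
  have amp_amp_in: "amp S (amp_in i \<xi>) = amp_in i (S \<xi>)" if "bounded_clinear S" "i \<in> F" for S i \<xi>
  proof -
    have "amp S (amp_in i \<xi>) = (\<Sum>j\<in>F. if j = i then amp_in i (S \<xi>) else 0)"
      unfolding amp_def using linear_0[OF bounded_linear.linear[OF bounded_clinearD(1)[OF that(1)]]]
        linear_0[OF bounded_linear.linear[OF lin(1)]]
      by (intro sum.cong) (auto simp: amp_out_in)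
    then show ?thesis using that F by simp
  qed
  have amp_out_amp: "amp_out i (amp S \<Xi>) = S (amp_out i \<Xi>)" if "i \<in> F" for S i \<Xi>
    unfolding amp_def lin using that F by (simp add: amp_out_in)
  define q where "q i j \<xi> = amp_out i (?Q (amp_in j \<xi>))" for i j \<xi>
  have q: "q i j (T \<xi>) = T (q i j \<xi>)" if "i \<in> F" "j \<in> F" for i j \<xi>
  proof (rule comm)
    show "bounded_clinear (q i j)"
      unfolding q_def
      by (intro bounded_clinear_compose[OF bounded_clinear_amp_out] bounded_clinear_compose[OF bounded_clinear_proj[OF V]] bounded_clinear_amp_in)
    show "q i j (S \<zeta>) = S (q i j \<zeta>)" if "S \<in> ops" for S \<zeta>
      using amp_amp_in[OF ops_bounded[OF that] \<open>j \<in> F\<close>, of \<zeta>] Q_amp[OF that, of "amp_in j \<zeta>"]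
        amp_out_amp[OF \<open>i \<in> F\<close>, of S "?Q (amp_in j \<zeta>)"]
      by (simp add: q_def)
  qed
  have Q_vec: "amp_out i (?Q (vec S)) = (\<Sum>j\<in>F. q i j (S (fst j)))" for i S
    unfolding vec_def q_def
    by (simp only: bounded_clinearD(5)[OF bounded_clinear_proj[OF V]] lin(10))
  let ?\<Xi> = "vec (\<lambda>\<xi>. \<xi>)"
  have "?\<Xi> \<in> V" using ops_id by (auto simp: V_def)
  then have "?\<Xi> \<in> closure V" using closure_subset by blast
  then have Q_id: "?Q ?\<Xi> = ?\<Xi>" by (rule proj_id)
  have out_vec: "amp_out i (vec S) = S (fst i)" if "i \<in> F" for S i
    unfolding vec_def lin using that F by (simp add: amp_out_in)
  \<comment> \<open>\<open>?Q\<close> fixes the vector of the identity. As \<open>T\<close> passes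
    through the entries \<open>q i j\<close>, the vector of \<open>T\<close> has the same components
    as its projection, so its components are approximated simultaneously by those of a vector in
    \<open>V\<close>.\<close>
  have T_out: "amp_out i (?Q (vec T)) = T (fst i)" if "i \<in> F" for i
  proof -
    have "amp_out i (?Q (vec T)) = T (\<Sum>j\<in>F. q i j (fst j))"
      unfolding Q_vec bounded_clinearD(5)[OF T] using q that by (intro sum.cong) auto
    also have "(\<Sum>j\<in>F. q i j (fst j)) = fst i"
      using Q_vec[of i "\<lambda>\<xi>. \<xi>"] Q_id out_vec[OF that] by simp
    finally show ?thesis .
  qed
  \<comment> \<open>A common strict bound for the norms of the second components, positive even if
    \<open>F\<close> is empty.\<close>
  define K where "K = 1 + (\<Sum>i\<in>F. norm (snd i))"
  have K: "0 < K" "\<And>i. i \<in> F \<Longrightarrow> norm (snd i) < K"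
  proof -
    show "0 < K" unfolding K_def by (intro add_pos_nonneg sum_nonneg) auto
    show "norm (snd i) < K" if "i \<in> F" for i
      using member_le_sum[OF that, of "\<lambda>i. norm (snd i)"] F by (simp add: K_def)
  qed
  obtain S where S: "S \<in> ops" "norm (vec S - ?Q (vec T)) < e / K"
  proof -
    have "\<exists>y\<in>V. dist y (?Q (vec T)) < e / K"
      using iffD1[OF closure_approachable proj_in[of "vec T"]] e K(1) by simp
    then show ?thesis using that by (auto simp: V_def dist_norm)
  qed
  have "cmod (cip (T \<xi>) \<eta> - cip (S \<xi>) \<eta>) < e" if "(\<xi>, \<eta>) \<in> F" for \<xi> \<eta>
  proof -
    have "S \<xi> - T \<xi> = amp_out (\<xi>, \<eta>) (vec S - ?Q (vec T))"
      using T_out[OF that] out_vec[OF that] by (simp add: lin)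
    then have "norm (S \<xi> - T \<xi>) < e / K"
      using norm_amp_out_le S(2) by (metis order_le_less_trans)
    then have "norm (T \<xi> - S \<xi>) < e / K" by (simp add: norm_minus_commute)
    have "cmod (cip (T \<xi>) \<eta> - cip (S \<xi>) \<eta>) \<le> norm (T \<xi> - S \<xi>) * norm \<eta>"
      by (simp add: cip_cauchy_schwarz flip: cip_diff_left)
    also have "\<dots> \<le> norm (T \<xi> - S \<xi>) * K"
      using K(2)[OF that] by (intro mult_left_mono) auto
    also have "\<dots> < e / K * K"
      using \<open>norm (T \<xi> - S \<xi>) < e / K\<close> K(1) by (intro mult_strict_right_mono)
    finally show ?thesis using K(1) by simp
  qed
  then show "\<exists>U\<in>ops. \<forall>(\<xi>, \<eta>)\<in>F. cmod (cip (T \<xi>) \<eta> - cip (U \<xi>) \<eta>) < e"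
    using S(1) by blast
qed

end

section \<open>Translations on a group\<close>

definition reindex :: "('a \<Rightarrow> 'a) \<Rightarrow> 'a l2 \<Rightarrow> 'a l2" where
  "reindex \<pi> \<xi> = l2_of (\<lambda>x. coord \<xi> (\<pi> x))"

lemma coord_reindex:
  assumes "bij \<pi>"
  shows "coord (reindex \<pi> \<xi>) x = coord \<xi> (\<pi> x)"
proof -
  have "(\<lambda>x. (cmod (coord \<xi> (\<pi> x)))\<^sup>2) summable_on UNIV"
    using summable_on_reindex_bij_betw[OF assms, of "\<lambda>x. (cmod (coord \<xi> x))\<^sup>2"]
    by (simp add: summable_coord)
  then show ?thesis by (simp add: reindex_def l2_of_inverse ell2_UNIV)
qed

lemma cip_reindex:
  assumes "bij \<pi>"
  shows "cip (reindex \<pi> \<xi>) (reindex \<pi> \<eta>) = cip \<xi> \<eta>"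
  using infsum_reindex_bij_betw[OF assms, of "\<lambda>x. coord \<xi> x * cnj (coord \<eta> x)"]
  by (simp add: cip_def coord_reindex[OF assms])

lemma bounded_clinear_reindex:
  assumes "bij \<pi>"
  shows "bounded_clinear (reindex \<pi>)"
proof -
  have "norm (reindex \<pi> \<xi>) = norm \<xi>" for \<xi>
    by (simp add: norm_l2_def inner_l2_def cip_reindex[OF assms])
  then show ?thesis
    unfolding bounded_clinear_def
    by (intro conjI allI bounded_linear_intro[of _ 1] l2_eqI)
      (auto simp: coord_reindex[OF assms] scaleR_cscale)
qed

locale group_on_UNIV = group G for G :: "'g monoid" (structure) +
  assumes carrier_UNIV [simp]: "carrier G = UNIV"
begin

lemma inv_solve: "inv x \<otimes> y = z \<longleftrightarrow> y = x \<otimes> z" "y \<otimes> inv x = z \<longleftrightarrow> y = z \<otimes> x"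
  using inv_solve_left'[of z x y] inv_solve_right'[of z y x] by auto

lemma inv_mult_cancel [simp]: "inv x \<otimes> (x \<otimes> y) = y" "x \<otimes> (inv x \<otimes> y) = y"
  by (simp_all flip: m_assoc)

lemma bij_translations:
  "bij (\<lambda>x. inv g \<otimes> x)" "bij (\<lambda>x. x \<otimes> g)" "bij (\<lambda>x. inv g \<otimes> x \<otimes> g)"
proof -
  show "bij (\<lambda>x. inv g \<otimes> x)"
    by (rule o_bij[of "\<lambda>x. g \<otimes> x"]) (auto simp: fun_eq_iff)
  show "bij (\<lambda>x. x \<otimes> g)"
    by (rule o_bij[of "\<lambda>x. x \<otimes> inv g"]) (auto simp: fun_eq_iff m_assoc)
  show "bij (\<lambda>x. inv g \<otimes> x \<otimes> g)"
    by (rule o_bij[of "\<lambda>x. g \<otimes> x \<otimes> inv g"]) (auto simp: fun_eq_iff m_assoc)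
qed

definition L :: "'g \<Rightarrow> 'g l2 \<Rightarrow> 'g l2" where "L g = reindex (\<lambda>x. inv g \<otimes> x)"
definition R :: "'g \<Rightarrow> 'g l2 \<Rightarrow> 'g l2" where "R g = reindex (\<lambda>x. x \<otimes> g)"
definition C :: "'g \<Rightarrow> 'g l2 \<Rightarrow> 'g l2" where "C g = reindex (\<lambda>x. inv g \<otimes> x \<otimes> g)"

lemma coord_translations [simp]:
  "coord (L g \<xi>) x = coord \<xi> (inv g \<otimes> x)"
  "coord (R g \<xi>) x = coord \<xi> (x \<otimes> g)"
  "coord (C g \<xi>) x = coord \<xi> (inv g \<otimes> x \<otimes> g)"
  by (simp_all add: L_def R_def C_def coord_reindex bij_translations)

lemma bounded_clinear_translations:
  "bounded_clinear (L g)" "bounded_clinear (R g)" "bounded_clinear (C g)"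
  by (simp_all add: L_def R_def C_def bounded_clinear_reindex bij_translations)

lemma translation_compose:
  "L g (L h \<xi>) = L (g \<otimes> h) \<xi>" "R g (R h \<xi>) = R (g \<otimes> h) \<xi>" "L g (R h \<xi>) = R h (L g \<xi>)"
  "C g \<xi> = L g (R g \<xi>)"
  by (rule l2_eqI; simp add: inv_mult_group m_assoc)+

lemma translation_ket [simp]:
  "L g (ket x) = ket (g \<otimes> x)" "R g (ket x) = ket (x \<otimes> inv g)" "C g (ket x) = ket (g \<otimes> x \<otimes> inv g)"
proof -
  show L: "L g (ket x) = ket (g \<otimes> x)" for x
    by (rule l2_eqI) (simp add: coord_ket inv_solve)
  show R: "R g (ket x) = ket (x \<otimes> inv g)"
    by (rule l2_eqI) (metis coord_ket coord_translations(2) inv_solve(2))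
  show "C g (ket x) = ket (g \<otimes> x \<otimes> inv g)"
    by (simp only: translation_compose(4) L R m_assoc carrier_UNIV UNIV_I)
qed

lemma translation_one [simp]: "L \<one> \<xi> = \<xi>" "R \<one> \<xi> = \<xi>"
  by (rule l2_eqI; simp)+

lemma cip_translations [simp]:
  "cip (L g \<xi>) (L g \<eta>) = cip \<xi> \<eta>" "cip (R g \<xi>) (R g \<eta>) = cip \<xi> \<eta>" "cip (C g \<xi>) (C g \<eta>) = cip \<xi> \<eta>"
  by (simp_all add: L_def R_def C_def cip_reindex bij_translations)

lemma norm_translations [simp]:
  "norm (L g \<xi>) = norm \<xi>" "norm (R g \<xi>) = norm \<xi>" "norm (C g \<xi>) = norm \<xi>"
  by (simp_all add: norm_l2_def inner_l2_def)

lemma cip_translation_adjoint: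
  "cip (L g \<xi>) \<eta> = cip \<xi> (L (inv g) \<eta>)" "cip (R g \<xi>) \<eta> = cip \<xi> (R (inv g) \<eta>)"
  using cip_translations(1)[of "inv g" "L g \<xi>" \<eta>] cip_translations(2)[of "inv g" "R g \<xi>" \<eta>]
  by (simp_all add: translation_compose)

lemma hadj_L: "hadj (L g) = L (inv g)"
  by (rule hadj_unique) (simp_all add: bounded_clinear_translations cip_translation_adjoint)

lemma left_translation_fun_op: "left_translation G g = fun_op (L g)"
  by (rule operator_eqI) (auto simp: left_translation_def fun_op_extensional)

text \<open>The commutant of the right translations. It is a von Neumann algebra containing all
  \<open>L g\<close>, hence all of \<open>L(G)\<close>, and by \<open>RC_ket\<close> its elements
  are determined by their value at \<open>ket \<one>\<close>.\<close>

definition RC :: "('g l2 \<Rightarrow> 'g l2) set" where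
  "RC = {T. bounded_clinear T \<and> (\<forall>g \<xi>. T (R g \<xi>) = R g (T \<xi>))}"

lemma RC_D: "T \<in> RC \<Longrightarrow> bounded_clinear T" "T \<in> RC \<Longrightarrow> T (R g \<xi>) = R g (T \<xi>)"
  by (simp_all add: RC_def)

lemma RC_id: "(\<lambda>\<xi>. \<xi>) \<in> RC"
  by (simp add: RC_def bounded_clinear_id)

lemma RC_add: "T \<in> RC \<Longrightarrow> U \<in> RC \<Longrightarrow> (\<lambda>\<xi>. T \<xi> + U \<xi>) \<in> RC"
  by (simp add: RC_def bounded_clinear_add bounded_clinearD(3)[OF bounded_clinear_translations(2)])

lemma RC_cscale: "T \<in> RC \<Longrightarrow> (\<lambda>\<xi>. cscale c (T \<xi>)) \<in> RC"
  by (simp add: RC_def bounded_clinear_compose[OF bounded_clinear_cscale]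
      bounded_clinearD(2)[OF bounded_clinear_translations(2)])

lemma RC_diff:
  assumes "T \<in> RC" "U \<in> RC"
  shows "(\<lambda>\<xi>. T \<xi> - U \<xi>) \<in> RC"
proof -
  have "(\<lambda>\<xi>. T \<xi> - U \<xi>) = (\<lambda>\<xi>. T \<xi> + cscale (-1) (U \<xi>))"
    by (intro ext l2_eqI) simp
  then show ?thesis using RC_add[OF assms(1) RC_cscale[OF assms(2), of "-1"]] by simp
qed

lemma RC_mult: "T \<in> RC \<Longrightarrow> U \<in> RC \<Longrightarrow> (\<lambda>\<xi>. T (U \<xi>)) \<in> RC"
  by (simp add: RC_def bounded_clinear_compose)

lemma RC_hadj:
  assumes T: "T \<in> RC"
  shows "hadj T \<in> RC"
  unfolding RC_def mem_Collect_eq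
proof (intro conjI allI bounded_clinear_hadj RC_D(1)[OF T] cip_left_eqI)
  fix g \<xi> \<eta>
  note adj = cip_hadj[OF RC_D(1)[OF T]]
  have "cip \<eta> (hadj T (R g \<xi>)) = cip (R (inv g) (T \<eta>)) \<xi>"
    unfolding adj[symmetric] cip_translation_adjoint(2) by simp
  also have "\<dots> = cip (R (inv g) \<eta>) (hadj T \<xi>)"
    unfolding adj[symmetric] RC_D(2)[OF T] ..
  also have "\<dots> = cip \<eta> (R g (hadj T \<xi>))"
    unfolding cip_translation_adjoint(2) by simp
  finally show "cip \<eta> (hadj T (R g \<xi>)) = cip \<eta> (R g (hadj T \<xi>))" .
qed

lemma RC_L: "L g \<in> RC"
  by (simp add: RC_def bounded_clinear_translations translation_compose)

lemma RC_ket: "T \<in> RC \<Longrightarrow> T (ket g) = R (inv g) (T (ket \<one>))"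
  using RC_D(2)[of T "inv g" "ket \<one>"] by simp

lemma von_neumann_algebra_RC: "von_neumann_algebra UNIV (fun_op ` RC)"
  unfolding von_neumann_algebra_def
proof (intro conjI ballI allI)
  show "fun_op ` RC \<subseteq> bounded_operators UNIV" by (auto simp: fun_op_bounded RC_D)
  show "op_id UNIV \<in> fun_op ` RC" by (simp add: op_id_fun_op RC_id)
  show "op_add UNIV A B \<in> fun_op ` RC" "op_mult UNIV A B \<in> fun_op ` RC"
    if "A \<in> fun_op ` RC" "B \<in> fun_op ` RC" for A B
    using that by (auto simp: op_add_fun_op op_mult_fun_op RC_add RC_mult)
  show "op_scale UNIV c A \<in> fun_op ` RC" "op_adjoint UNIV A \<in> fun_op ` RC"
    if "A \<in> fun_op ` RC" for A c
    using that by (auto simp: op_scale_fun_op op_adjoint_fun_op RC_cscale RC_hadj RC_D)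
  let ?W = "weak_operator_topology (UNIV :: 'g set)"
  \<comment> \<open>With \<open>R g\<close> moved to the second vector, commutation becomes a family
    of equations between two matrix coefficients of the same operator, each of which defines a
    weakly closed set.\<close>
  let ?E = "\<lambda>g \<xi> \<eta>. {A \<in> topspace ?W. ell2_inner UNIV (A (coord (R g \<xi>))) (coord \<eta>)
      = ell2_inner UNIV (A (coord \<xi>)) (coord (R (inv g) \<eta>))}"
  have "closedin ?W (?E g \<xi> \<eta>)" for g \<xi> \<eta>
    by (rule closedin_continuous_maps_eq[where Y = euclidean]) (auto intro: wot_continuous_coefficient)
  then have "closedin ?W (\<Inter>(g, \<xi>, \<eta>). ?E g \<xi> \<eta>)"
    by (intro closedin_Inter) auto
  also have "(\<Inter>(g, \<xi>, \<eta>). ?E g \<xi> \<eta>) = fun_op ` RC"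
  proof (intro equalityI subsetI)
    fix A assume A: "A \<in> (\<Inter>(g, \<xi>, \<eta>). ?E g \<xi> \<eta>)"
    then have "A \<in> bounded_operators UNIV" by (auto simp: topspace_wot)
    then obtain T where T: "bounded_clinear T" "A = fun_op T" by (rule bounded_operators_cases)
    have "T (R g \<xi>) = R g (T \<xi>)" for g \<xi>
    proof (rule l2_eqI)
      fix x
      have "A \<in> ?E g \<xi> (ket x)" using A by blast
      then have "cip (T (R g \<xi>)) (ket x) = cip (T \<xi>) (R (inv g) (ket x))"
        by (simp only: mem_Collect_eq T(2) fun_op_coord ell2_inner_coord)
      then show "coord (T (R g \<xi>)) x = coord (R g (T \<xi>)) x" by simp
    qed
    with T show "A \<in> fun_op ` RC" by (simp add: RC_def)
  qed (auto simp: topspace_wot fun_op_bounded RC_D ell2_inner_coord cip_translation_adjoint)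
  finally show "closedin ?W (fun_op ` RC)" .
qed

lemma group_vn_algebra_subset_RC: "group_vn_algebra G UNIV \<subseteq> fun_op ` RC"
  unfolding group_vn_algebra_def vn_generated_def
  by (rule Inter_lower) (auto simp: von_neumann_algebra_RC left_translation_fun_op RC_L)

text \<open>The coordinate at \<open>\<one>\<close> is a sum over \<open>x\<close> of the coordinate
  of \<open>T (ket \<one>)\<close> at \<open>x\<close> times that of \<open>S (ket \<one>)\<close>
  at \<open>inv x\<close>; substituting \<open>inv x\<close> for \<open>x\<close> exchanges
  \<open>S\<close> and \<open>T\<close>.\<close>

lemma trace_commute:
  assumes "S \<in> RC" "T \<in> RC"
  shows "cip (S (T (ket \<one>))) (ket \<one>) = cip (T (S (ket \<one>))) (ket \<one>)"
proof -
  have formula: "cip (A (B (ket \<one>))) (ket \<one>) = (\<Sum>\<^sub>\<infinity>x. coord (B (ket \<one>)) x * coord (A (ket \<one>)) (inv x))"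
    if "A \<in> RC" "B \<in> RC" for A B
  proof -
    have "cnj (coord (hadj A (ket \<one>)) x) = coord (A (ket \<one>)) (inv x)" for x
    proof -
      have "cnj (coord (hadj A (ket \<one>)) x) = coord (A (ket x)) \<one>"
        using cip_hadj[OF RC_D(1)[OF that(1)], of "ket x" "ket \<one>"] by simp
      then show ?thesis by (simp add: RC_ket[OF that(1), of x])
    qed
    then show ?thesis
      unfolding cip_hadj[OF RC_D(1)[OF that(1)]] by (simp add: cip_def)
  qed
  have "bij (\<lambda>x. inv x)"
    by (rule o_bij[of "\<lambda>x. inv x"]) (auto simp: fun_eq_iff)
  from infsum_reindex_bij_betw[OF this, of "\<lambda>x. coord (T (ket \<one>)) x * coord (S (ket \<one>)) (inv x)"]
  show ?thesis by (simp add: formula assms mult.commute del: cip_ket_right)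
qed

lemma norm_RC_ket: "T \<in> RC \<Longrightarrow> norm (T (ket g)) = norm (T (ket \<one>))"
  by (subst RC_ket) simp_all

text \<open>Traciality applied to \<open>T\<close> and its adjoint. With \<open>norm_RC_ket\<close>,
  the norm of \<open>T (ket \<one>)\<close> controls both operators on every basis vector.\<close>

lemma norm_hadj_RC_ket:
  assumes "T \<in> RC"
  shows "norm (hadj T (ket g)) = norm (T (ket \<one>))"
proof -
  have "cip (hadj T (ket \<one>)) (hadj T (ket \<one>)) = cip (T (ket \<one>)) (T (ket \<one>))"
    using trace_commute[OF assms RC_hadj[OF assms]] RC_D(1)[OF assms]
    by (metis cip_hadj cip_hadj')
  then show ?thesis
    using norm_RC_ket[OF RC_hadj[OF assms], of g] by (simp add: norm_l2_def inner_l2_def)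
qed

text \<open>
  No uniform bound on \<open>S n\<close> is needed: for \<open>D = T - S n\<close>, the vectors \<open>D (ket g)\<close> and
  \<open>hadj D (ket h)\<close> all have the norm of \<open>D (ket \<one>)\<close>, by traciality, so that the commutators
  of \<open>T\<close> with the commutant have zero matrix coefficients.
\<close>

theorem RC_limit_in_ops:
  assumes M: "von_neumann_algebra UNIV M" and T: "T \<in> RC"
    and S: "\<And>n. S n \<in> vn.ops M" "\<And>n. S n \<in> RC" and lim: "(\<lambda>n. S n (ket \<one>)) \<longlonglongrightarrow> T (ket \<one>)"
  shows "T \<in> vn.ops M"
proof -
  interpret vn M by standard (rule M)
  show ?thesis
  proof (rule double_commutant[OF RC_D(1)[OF T]])
    fix A \<xi> assume A: "bounded_clinear A" "\<And>S \<xi>. S \<in> ops \<Longrightarrow> A (S \<xi>) = S (A \<xi>)"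
    have "(\<lambda>\<xi>. A (T \<xi>)) = (\<lambda>\<xi>. T (A \<xi>))"
    proof (rule bounded_clinear_eqI)
      show "bounded_clinear (\<lambda>\<xi>. A (T \<xi>))" "bounded_clinear (\<lambda>\<xi>. T (A \<xi>))"
        by (rule bounded_clinear_compose, (rule A(1) RC_D(1)[OF T])+)+
      fix g show "A (T (ket g)) = T (A (ket g))"
      proof (rule l2_eqI)
        fix h
        define D where "D n \<xi> = T \<xi> - S n \<xi>" for n \<xi>
        have D: "D n \<in> RC" for n unfolding D_def by (intro RC_diff T S)
        have D0: "(\<lambda>n. norm (D n (ket \<one>))) \<longlonglongrightarrow> 0"
          using tendsto_norm[OF tendsto_diff[OF tendsto_const[of "T (ket \<one>)"] lim]] by (simp add: D_def)
        define c where "c = norm (hadj A (ket h)) + norm (A (ket g))"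
        have "cmod (coord (A (T (ket g))) h - coord (T (A (ket g))) h) \<le> norm (D n (ket \<one>)) * c" for n
        proof -
          \<comment> \<open>\<open>S n\<close> commutes with \<open>A\<close>, so \<open>T\<close>
            may be replaced by \<open>D n\<close> in the commutator.\<close>
          have "A (T (ket g)) - T (A (ket g)) = A (D n (ket g)) - D n (A (ket g))"
            by (simp add: D_def bounded_clinearD[OF A(1)] A(2)[OF S(1)])
          then have "coord (A (T (ket g))) h - coord (T (A (ket g))) h
              = cip (A (D n (ket g))) (ket h) - cip (D n (A (ket g))) (ket h)"
            by (metis cip_diff_left cip_ket_right)
          also have "\<dots> = cip (D n (ket g)) (hadj A (ket h)) - cip (A (ket g)) (hadj (D n) (ket h))"
            by (simp only: cip_hadj A(1) RC_D(1)[OF D])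
          also have "cmod \<dots> \<le> norm (D n (ket g)) * norm (hadj A (ket h))
              + norm (A (ket g)) * norm (hadj (D n) (ket h))"
            by (intro order_trans[OF norm_triangle_ineq4] add_mono cip_cauchy_schwarz)
          also have "\<dots> = norm (D n (ket \<one>)) * c"
            unfolding norm_RC_ket[OF D, of n g] norm_hadj_RC_ket[OF D] by (simp add: c_def algebra_simps)
          finally show ?thesis .
        qed
        then have "cmod (coord (A (T (ket g))) h - coord (T (A (ket g))) h) \<le> 0 * c"
          by (intro tendsto_lowerbound[OF tendsto_mult_right[OF D0, of c]]) auto
        then show "coord (A (T (ket g))) h = coord (T (A (ket g))) h" by simp
      qed
    qed
    then show "A (T \<xi>) = T (A \<xi>)" by (rule fun_cong)
  qed
qed

end

section \<open>Invariant subalgebras\<close>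

locale invariant_algebra = group_on_UNIV +
  fixes P :: "'a operator set"
  assumes invariant: "invariant_vn_subalgebra G P"
begin

sublocale vn P
  using invariant by unfold_locales (simp add: invariant_vn_subalgebra_def)

lemma ops_RC: "T \<in> ops \<Longrightarrow> T \<in> RC"
  using invariant group_vn_algebra_subset_RC
  by (auto simp: invariant_vn_subalgebra_def ops_iff fun_op_inject subset_iff image_iff)

lemma ops_conjugate:
  assumes "T \<in> ops"
  shows "(\<lambda>\<xi>. L g (T (L (inv g) \<xi>))) \<in> ops"
proof -
  have "op_mult UNIV (op_mult UNIV (fun_op (L g)) (fun_op T)) (op_adjoint UNIV (fun_op (L g))) \<in> P"
    using invariant assms by (auto simp: invariant_vn_subalgebra_def left_translation_fun_op ops_iff)
  then show ?thesis
    by (simp add: ops_iff op_mult_fun_op op_adjoint_fun_op bounded_clinear_translations hadj_L)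
qed

definition V :: "'a l2 set" where "V = (\<lambda>T. T (ket \<one>)) ` ops"
definition K :: "'a l2 set" where "K = closure V"
definition v :: "'a \<Rightarrow> 'a l2" where "v g = proj K (ket g)"

lemma V_I: "T \<in> ops \<Longrightarrow> T (ket \<one>) \<in> V"
  by (simp add: V_def)

lemma csubspace_V: "csubspace V"
  unfolding csubspace_def V_def
  using ops_zero ops_add ops_cscale by fastforce

sublocale K: closed_subspace K
  unfolding K_def by (rule closed_subspace_closure[OF csubspace_V])

lemma bounded_clinear_proj_K: "bounded_clinear (proj K)"
  unfolding K_def by (rule bounded_clinear_proj[OF csubspace_V])

lemma ops_in_K: "T \<in> ops \<Longrightarrow> T (ket \<one>) \<in> K"
  unfolding K_def by (rule subsetD[OF closure_subset V_I])

lemma csubspace_K: "csubspace K"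
  unfolding K_def by (rule closure_csubspace[OF csubspace_V])

lemma K_induct:
  assumes "\<xi> \<in> K" "\<And>T. T \<in> ops \<Longrightarrow> Q (T (ket \<one>))" "closed {\<xi>. Q \<xi>}"
  shows "Q \<xi>"
  using closure_minimal[of V "{\<xi>. Q \<xi>}"] assms by (auto simp: K_def V_def)

lemma cip_proj_K: "cip (proj K \<xi>) \<eta> = cip \<xi> (proj K \<eta>)"
  by (intro cip_eq_of_inner bounded_clinear_proj_K K.inner_proj)

lemma v_in_K: "v g \<in> K"
  by (simp add: v_def K.proj_in)

text \<open>The matrix of \<open>proj K\<close> is hermitian. This allows support statements about
  \<open>v g\<close> to be read in both directions.\<close>

lemma coord_v_commute: "coord (v g) x = cnj (coord (v x) g)"
  using cip_proj_K[of "ket g" "ket x"] by (simp add: v_def)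

text \<open>The vectors \<open>v x\<close> form the reproducing kernel of \<open>K\<close>: a linear
  condition on all of \<open>K\<close> results from knowing a single \<open>v x\<close>.\<close>

lemma coord_K: "\<xi> \<in> K \<Longrightarrow> coord \<xi> x = cip \<xi> (v x)"
  using cip_proj_K[of \<xi> "ket x"] by (simp add: v_def K.proj_id)

lemma v_one: "v \<one> = ket \<one>"
  using ops_in_K[OF ops_id] by (simp add: v_def K.proj_id)

lemma v_self: "coord (v g) g = of_real ((norm (v g))\<^sup>2)"
  using coord_K[OF v_in_K, of g g] by (simp add: cip_self_norm)

lemma v_conjugate: "v (k \<otimes> g \<otimes> inv k) = C k (v g)"
proof -
  have C_V: "C h ` V \<subseteq> V" for h
  proof -
    have "C h (T (ket \<one>)) \<in> V" if "T \<in> ops" for T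
    proof -
      \<comment> \<open>\<open>L (inv h) (ket \<one>)\<close> equals
        \<open>R h (ket \<one>)\<close>, and \<open>T\<close> commutes with \<open>R h\<close>; so
        on vectors, conjugating the operator is the map \<open>C h\<close>.\<close>
      have "C h (T (ket \<one>)) = L h (T (L (inv h) (ket \<one>)))"
        using RC_ket[OF ops_RC[OF that], of "inv h"] by (simp add: translation_compose)
      then show ?thesis using V_I[OF ops_conjugate[OF that, of h]] by simp
    qed
    then show ?thesis by (auto simp: V_def)
  qed
  have "inner (C k \<xi>) \<eta> = inner \<xi> (C (inv k) \<eta>)" for \<xi> \<eta>
  proof -
    have "C k (C (inv k) \<eta>) = \<eta>" by (rule l2_eqI) (simp add: m_assoc)
    then show ?thesis
      using cip_translations(3)[of k \<xi> "C (inv k) \<eta>"] by (simp add: inner_l2_def)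
  qed
  then have "proj K (C k (ket g)) = C k (proj K (ket g))"
    unfolding K_def
    by (intro proj_intertwines[OF csubspace_V, where T' = "C (inv k)"]
        bounded_clinearD(1)[OF bounded_clinear_translations(3)] C_V)
  then show ?thesis by (simp add: v_def)
qed

lemma coord_v_conjugate: "coord (v (k \<otimes> g \<otimes> inv k)) (k \<otimes> x \<otimes> inv k) = coord (v g) x"
  unfolding v_conjugate by (simp add: m_assoc)

lemma norm_v_conjugate: "norm (v (k \<otimes> g \<otimes> inv k)) = norm (v g)"
  by (simp add: v_conjugate)

text \<open>The way back from vectors to operators. The approximating vectors come from operators in
  \<open>ops\<close> whose operator norms are not controlled, which is exactly the situation of
  \<open>RC_limit_in_ops\<close>.\<close>

lemma in_ops_if_ket_in_K:
  assumes "T \<in> RC" "T (ket \<one>) \<in> K"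
  shows "T \<in> ops"
proof -
  obtain f where f: "\<And>n. f n \<in> V" "f \<longlonglongrightarrow> T (ket \<one>)"
    using assms(2) by (auto simp: K_def closure_sequential)
  then have "\<forall>n. \<exists>S\<in>ops. f n = S (ket \<one>)" by (auto simp: V_def)
  then obtain S where S: "\<And>n. S n \<in> ops" "\<And>n. f n = S n (ket \<one>)" by metis
  show ?thesis
    using f(2) unfolding S(2) by (rule RC_limit_in_ops[OF vn assms(1) S(1) ops_RC[OF S(1)]])
qed

text \<open>The bimodule property of a conditional expectation: multiplication by an element of the
  algebra, on either side, preserves \<open>V\<close>, and so does its adjoint.\<close>

lemma proj_mult:
  assumes "L s \<in> ops"
  shows "v (s \<otimes> g) = L s (v g)" "v (g \<otimes> s) = R (inv s) (v g)"
proof -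
  have hadj_ops: "L (inv s) \<in> ops" using ops_hadj[OF assms] by (simp add: hadj_L)
  have L: "L t ` V \<subseteq> V" if "L t \<in> ops" for t
    using ops_mult[OF that] by (auto simp: V_def)
  have R: "R t ` V \<subseteq> V" if "L (inv t) \<in> ops" for t
  proof -
    have "R t (T (ket \<one>)) \<in> V" if "T \<in> ops" for T
      using V_I[OF ops_mult[OF that \<open>L (inv t) \<in> ops\<close>]] RC_ket[OF ops_RC[OF that], of "inv t"] by simp
    then show ?thesis by (auto simp: V_def)
  qed
  have "proj K (L s (ket g)) = L s (proj K (ket g))"
    unfolding K_def
    by (intro proj_intertwines[OF csubspace_V, where T' = "L (inv s)"]
        bounded_clinearD(1)[OF bounded_clinear_translations(1)] L assms hadj_ops)
      (simp add: inner_l2_def cip_translation_adjoint)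
  moreover have "proj K (R (inv s) (ket g)) = R (inv s) (proj K (ket g))"
    unfolding K_def
    by (intro proj_intertwines[OF csubspace_V, where T' = "R s"]
        bounded_clinearD(1)[OF bounded_clinear_translations(2)] R)
      (simp_all add: assms hadj_ops inner_l2_def cip_translation_adjoint)
  ultimately show "v (s \<otimes> g) = L s (v g)" "v (g \<otimes> s) = R (inv s) (v g)"
    by (simp_all add: v_def)
qed

text \<open>\<open>\<xi>\<close> is constant on the orbit of \<open>x\<close> under conjugation by
  \<open>A\<close>, and a square-summable function takes a non-zero value only finitely
  often.\<close>

lemma coord_zero_of_infinite_orbit:
  assumes fixed: "\<And>h. h \<in> A \<Longrightarrow> C h \<xi> = \<xi>"
    and inf: "infinite ((\<lambda>h. h \<otimes> x \<otimes> inv h) ` A)"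
  shows "coord \<xi> x = 0"
proof (rule ccontr)
  assume nz: "coord \<xi> x \<noteq> 0"
  let ?c = "(cmod (coord \<xi> x))\<^sup>2"
  obtain n where n: "(norm \<xi>)\<^sup>2 / ?c < real n" using reals_Archimedean2 by blast
  obtain F where F: "F \<subseteq> (\<lambda>h. h \<otimes> x \<otimes> inv h) ` A" "finite F" "card F = n"
    using infinite_arbitrarily_large[OF inf] by metis
  have "coord \<xi> y = coord \<xi> x" if y: "y \<in> F" for y
  proof -
    obtain h where h: "h \<in> A" "y = h \<otimes> x \<otimes> inv h" using F(1) y by blast
    have "coord \<xi> y = coord (C h \<xi>) y" by (simp only: fixed[OF h(1)])
    also have "\<dots> = coord \<xi> x" by (simp add: h(2) m_assoc)
    finally show ?thesis .
  qed
  then have "(\<Sum>y\<in>F. (cmod (coord \<xi> y))\<^sup>2) = real n * ?c" by (simp add: F(3))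
  then have "real n * ?c \<le> (norm \<xi>)\<^sup>2" using sum_coord_le[OF F(2), of \<xi>] by simp
  with n nz show False by (simp add: divide_less_eq)
qed

text \<open>For vectors of operators \<open>A\<close> and \<open>B\<close> in the algebra,
  traciality turns the inner product into the coordinate at \<open>s\<close> of the vector of
  \<open>A\<close> composed with \<open>hadj B\<close>. That vector lies in \<open>K\<close>, so the
  coordinate is its inner product with \<open>v s\<close>. Continuity in each argument extends this
  to the closure.\<close>

lemma K_orthogonal:
  assumes s: "v s = 0" and \<xi>: "\<xi> \<in> K" and \<eta>: "\<eta> \<in> K"
  shows "cip \<xi> (L s \<eta>) = 0"
proof -
  have 1: "cip (A (ket \<one>)) (L s (B (ket \<one>))) = 0" if A: "A \<in> ops" and B: "B \<in> ops" for A B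
  proof -
    note b = RC_D(1)[OF ops_RC[OF A]] RC_D(1)[OF ops_RC[OF B]]
    have "cip (A (ket \<one>)) (L s (B (ket \<one>))) = cip (hadj B (L (inv s) (A (ket \<one>)))) (ket \<one>)"
      by (simp only: cip_hadj'[OF b(2)] cip_translation_adjoint inv_inv carrier_UNIV UNIV_I)
    also have "\<dots> = cip (L (inv s) (A (hadj B (ket \<one>)))) (ket \<one>)"
      by (rule trace_commute[where T = "\<lambda>\<xi>. L (inv s) (A \<xi>)"])
        (intro RC_hadj RC_mult[OF RC_L] ops_RC A B)+
    also have "\<dots> = coord (A (hadj B (ket \<one>))) s" by simp
    also have "\<dots> = 0"
    proof -
      have "A (hadj B (ket \<one>)) \<in> K" by (rule ops_in_K[OF ops_mult[OF A ops_hadj[OF B]]])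
      then show ?thesis using s by (simp add: coord_K)
    qed
    finally show ?thesis .
  qed
  have cl: "closed {\<xi>. f \<xi> = 0}" if "bounded_linear f" for f :: "'a l2 \<Rightarrow> complex"
    by (intro closed_Collect_eq linear_continuous_on that continuous_on_const)
  have 2: "cip \<xi> (L s (B (ket \<one>))) = 0" if "B \<in> ops" for B
    using \<xi> by (rule K_induct) (simp_all add: 1 that cl bounded_linear_cip_left)
  show ?thesis
    using \<eta> by (rule K_induct)
     (simp_all add: 2 cl bounded_linear_compose[OF bounded_linear_cip_right
          bounded_clinearD(1)[OF bounded_clinear_translations(1)]])
qed

end

context invariant_algebra
begin

text \<open>
  The vectors \<^term>\<open>L (inv (h q)) (v (h q))\<close> are pairwise orthogonal, of the same norm, and
  have the same inner product with \<^term>\<open>ket \<one>\<close>, so Bessel's inequality forces them to vanish.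
\<close>

lemma v_zero_of_infinite_family:
  assumes Q: "infinite Q" and h: "\<And>q. q \<in> Q \<Longrightarrow> h q = k q \<otimes> g \<otimes> inv (k q)"
    and zero: "\<And>q q'. q \<in> Q \<Longrightarrow> q' \<in> Q \<Longrightarrow> q \<noteq> q' \<Longrightarrow> v (h q \<otimes> inv (h q')) = 0"
  shows "v g = 0"
proof (rule ccontr)
  assume nz: "v g \<noteq> 0"
  define c where "c = (norm (v g))\<^sup>2"
  have c: "c > 0" using nz by (simp add: c_def)
  define w where "w q = L (inv (h q)) (v (h q))" for q
  have norm_v: "(norm (v (h q)))\<^sup>2 = c" if "q \<in> Q" for q
    by (simp add: h[OF that] norm_v_conjugate c_def)
  obtain n where n: "1 / c < real n" using reals_Archimedean2 by blast
  obtain F where F: "F \<subseteq> Q" "finite F" "card F = n"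
    using infinite_arbitrarily_large[OF Q] by metis
  have "cip (w q) (w q') = 0" if "q \<in> F" "q' \<in> F" "q \<noteq> q'" for q q'
  proof -
    have "cip (w q) (w q') = cip (v (h q)) (L (h q \<otimes> inv (h q')) (v (h q')))"
      by (simp add: w_def cip_translation_adjoint translation_compose)
    also have "\<dots> = 0"
      using that F(1) by (intro K_orthogonal zero v_in_K) auto
    finally show ?thesis .
  qed
  then have "(norm (\<Sum>q\<in>F. w q))\<^sup>2 = (\<Sum>q\<in>F. (norm (w q))\<^sup>2)"
    by (intro norm_sum_Pythagorean F) (auto simp: pairwise_def orthogonal_def inner_l2_def)
  also have "\<dots> = (\<Sum>q\<in>F. c)"
    using norm_v F(1) by (intro sum.cong) (auto simp: w_def)
  finally have norm_sum: "(norm (\<Sum>q\<in>F. w q))\<^sup>2 = real n * c" using F(3) by simp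
  have "coord (\<Sum>q\<in>F. w q) \<one> = (\<Sum>q\<in>F. of_real c)"
    unfolding coord_sum using F(1) norm_v by (intro sum.cong) (auto simp: w_def v_self simp flip: of_real_power)
  then have "cmod (coord (\<Sum>q\<in>F. w q) \<one>) = real n * c" using F(3) c by (simp add: norm_mult)
  \<comment> \<open>The squared norm of the sum and its coordinate at \<open>\<one>\<close> are both
    \<open>real n * c\<close>, while \<open>n\<close> was chosen to make this number exceed
    1.\<close>
  then have "(real n * c)\<^sup>2 \<le> real n * c"
    unfolding norm_sum[symmetric] by (metis coord_le_norm norm_ge_zero power_mono)
  moreover have "1 < real n * c" using n c by (simp add: divide_less_eq)
  ultimately show False
    using mult_strict_right_mono[of 1 "real n * c" "real n * c"] by (simp add: power2_eq_square)
qed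

text \<open>By \<open>coord_K\<close> the vector of an operator in \<open>P\<close> is supported on
  \<open>H\<close>. It is therefore a limit of vectors of operators in any von Neumann algebra
  \<open>M\<close> containing the translations by \<open>H\<close>, and
  \<open>RC_limit_in_ops\<close> places the operator itself in \<open>M\<close>.\<close>

lemma P_eq_group_vn_algebra:
  assumes v: "\<And>g. v g = 0 \<or> v g = ket g"
  shows "\<exists>H. H \<lhd> G \<and> P = group_vn_algebra G H"
proof (intro exI conjI)
  define H where "H = {g. L g \<in> ops}"
  have H: "g \<in> H" if "v g = ket g" for g
    using in_ops_if_ket_in_K[OF RC_L[of g]] v_in_K[of g] that by (simp add: H_def)
  have "subgroup H G"
  proof
    show "x \<otimes> y \<in> H" if "x \<in> H" "y \<in> H" for x y
      using ops_mult[of "L x" "L y"] that by (simp add: H_def translation_compose eta_contract_eq)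
    have "L \<one> = (\<lambda>\<xi>. \<xi>)" by (rule ext) simp
    then show "\<one> \<in> H" using ops_id by (simp add: H_def)
    show "inv x \<in> H" if "x \<in> H" for x
      using ops_hadj[of "L x"] that by (simp add: H_def hadj_L)
  qed auto
  moreover have "x \<otimes> h \<otimes> inv x \<in> H" if "h \<in> H" for x h
    using ops_conjugate[of "L h" x] that by (simp add: H_def translation_compose m_assoc eta_contract_eq)
  ultimately show "H \<lhd> G" by (simp add: normal_inv_iff)
  show "P = group_vn_algebra G H"
  proof
    show "group_vn_algebra G H \<subseteq> P"
      unfolding group_vn_algebra_def vn_generated_def carrier_UNIV
      by (rule Inter_lower) (auto simp: vn left_translation_fun_op H_def ops_iff)
    show "P \<subseteq> group_vn_algebra G H"
      unfolding group_vn_algebra_def vn_generated_def carrier_UNIV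
    proof (intro Inter_greatest subsetI)
      fix M A assume "M \<in> {M. von_neumann_algebra UNIV M \<and> left_translation G ` H \<subseteq> M}" "A \<in> P"
      then have M: "von_neumann_algebra UNIV M" "left_translation G ` H \<subseteq> M" by auto
      interpret M: vn M by standard (rule M)
      obtain T where T: "T \<in> ops" "A = fun_op T" using \<open>A \<in> P\<close> by (rule M_cases)
      have supp: "coord (T (ket \<one>)) g = 0" if "g \<notin> H" for g
        using coord_K[OF ops_in_K[OF T(1)], of g] v[of g] H[of g] that by auto
      \<comment> \<open>\<open>M\<close> is arbitrary and may extend beyond \<open>L(G)\<close>;
        cutting it down to \<open>RC\<close> keeps the operators that are controlled by their
        vectors.\<close>
      define W where "W = (\<lambda>S. S (ket \<one>)) ` (M.ops \<inter> RC)"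
      have W: "csubspace W"
        unfolding csubspace_def
      proof (intro conjI ballI allI)
        have W_I: "S (ket \<one>) \<in> W" if "S \<in> M.ops" "S \<in> RC" for S
          using that by (auto simp: W_def)
        have "cscale 0 (ket \<one>) = 0" by (rule l2_eqI) simp
        then show "0 \<in> W"
          using W_I[OF M.ops_cscale[OF M.ops_id, of 0] RC_cscale[OF RC_id, of 0]] by simp
        fix \<xi> assume "\<xi> \<in> W"
        then obtain S where S: "S \<in> M.ops" "S \<in> RC" "\<xi> = S (ket \<one>)" by (auto simp: W_def)
        show "cscale c \<xi> \<in> W" for c
          unfolding S(3) by (rule W_I[OF M.ops_cscale[OF S(1)] RC_cscale[OF S(2)]])
        fix \<eta> assume "\<eta> \<in> W"
        then obtain U where U: "U \<in> M.ops" "U \<in> RC" "\<eta> = U (ket \<one>)" by (auto simp: W_def)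
        show "\<xi> + \<eta> \<in> W"
          unfolding S(3) U(3) by (rule W_I[OF M.ops_add[OF S(1) U(1)] RC_add[OF S(2) U(2)]])
      qed
      interpret W: closed_subspace "closure W" by (rule closed_subspace_closure[OF W])
      have ket_W: "ket g \<in> closure W" if "g \<in> H" for g
      proof -
        have "L g \<in> M.ops \<inter> RC"
          using M(2) that by (auto simp: M.ops_iff RC_L left_translation_fun_op)
        then have "L g (ket \<one>) \<in> W" unfolding W_def by blast
        then show ?thesis using closure_subset by auto
      qed
      define D where "D = T (ket \<one>) - proj (closure W) (T (ket \<one>))"
      \<comment> \<open>\<open>D\<close> vanishes on \<open>H\<close> because it is orthogonal to
        \<open>ket g\<close> there, and the vector of \<open>T\<close> vanishes off
        \<open>H\<close>. So \<open>D\<close> is orthogonal to both terms of its definition.\<close>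
      have "coord D g * cnj (coord (T (ket \<one>)) g) = 0" for g
      proof (cases "g \<in> H")
        case True
        then have "inner D (ket g) = 0" "inner D (cscale \<i> (ket g)) = 0"
          using ket_W closure_csubspace[OF W] unfolding D_def csubspace_def
          by (auto intro: W.proj_orth)
        then have "cip D (ket g) = 0" by (simp add: cip_inner complex_eq_iff)
        then show ?thesis by simp
      qed (simp add: supp)
      then have "cip D (T (ket \<one>)) = 0" unfolding cip_def by (rule infsum_0)
      then have "inner D (T (ket \<one>)) = 0" by (simp add: inner_l2_def)
      moreover have "inner D (proj (closure W) (T (ket \<one>))) = 0"
        unfolding D_def by (rule W.proj_orth[OF W.proj_in])
      ultimately have "inner D D = 0" by (subst (2) D_def) (simp add: inner_diff_right)
      then have "D = 0" by simp
      then have "T (ket \<one>) - proj (closure W) (T (ket \<one>)) = 0" by (simp add: D_def)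
      then have "T (ket \<one>) \<in> closure W" using W.proj_in[of "T (ket \<one>)"] by simp
      then obtain f where f: "\<And>n. f n \<in> W" "f \<longlonglongrightarrow> T (ket \<one>)"
        by (auto simp: closure_sequential)
      then have "\<forall>n. \<exists>S\<in>M.ops \<inter> RC. f n = S (ket \<one>)" by (auto simp: W_def)
      then obtain S where S: "\<And>n. S n \<in> M.ops \<inter> RC" "\<And>n. f n = S n (ket \<one>)" by metis
      have "T \<in> M.ops"
        using f(2) S(1) unfolding S(2) by (intro RC_limit_in_ops[OF M(1) ops_RC[OF T(1)]]) auto
      then show "A \<in> M" by (simp add: T(2) M.ops_iff)
    qed
  qed
qed

end

section \<open>Groups containing the finitary permutations\<close>

text \<open>Group elements are kept apart from the permutations that they induce, so that the final
  group can be carried by \<open>nat\<close>.\<close>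

locale finitary_extension = group_on_UNIV G for G :: "'g monoid" (structure) +
  fixes act :: "'g \<Rightarrow> 'x \<Rightarrow> 'x"
  assumes infinite_points: "infinite (UNIV :: 'x set)"
    and bij_act: "bij (act g)"
    and act_mult: "act (g \<otimes> h) z = act g (act h z)"
    and faithful: "act g = act h \<Longrightarrow> g = h"
    and finitary: "bij f \<Longrightarrow> finite {z. f z \<noteq> z} \<Longrightarrow> f \<in> range act"
begin

lemma act_eqI: "(\<And>z. act g z = act h z) \<Longrightarrow> g = h"
  by (auto intro: faithful)

lemma act_inj [simp]: "act g y = act g z \<longleftrightarrow> y = z"
  using bij_act[of g] by (auto simp: bij_def inj_def)

lemma act_one [simp]: "act \<one> z = z"
  using act_mult[of \<one> \<one> z] by simp

lemma act_inv_cancel [simp]: "act (inv g) (act g z) = z" "act g (act (inv g) z) = z"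
  by (simp_all flip: act_mult)

lemma act_inv_eq_iff: "act (inv g) y = z \<longleftrightarrow> y = act g z"
  by auto

definition moved :: "'g \<Rightarrow> 'x set" where "moved g = {z. act g z \<noteq> z}"

lemma moved_mult: "moved (g \<otimes> h) \<subseteq> moved g \<union> moved h"
  by (auto simp: moved_def act_mult)

lemma moved_inv [simp]: "moved (inv g) = moved g"
  by (auto simp: moved_def act_inv_eq_iff)

lemma act_moved: "z \<in> moved g \<Longrightarrow> act g z \<in> moved g"
  by (auto simp: moved_def)

lemma moved_empty: "moved g = {} \<Longrightarrow> g = \<one>"
  by (rule act_eqI) (auto simp: moved_def)

lemma commute_if_disjoint:
  assumes "moved g \<inter> moved h = {}"
  shows "g \<otimes> h = h \<otimes> g"
proof (rule act_eqI)
  fix z show "act (g \<otimes> h) z = act (h \<otimes> g) z"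
    using assms act_moved[of z g] act_moved[of z h] unfolding act_mult moved_def disjoint_iff mem_Collect_eq
    by metis
qed

definition tr :: "'x \<Rightarrow> 'x \<Rightarrow> 'g" where "tr a b = inv_into UNIV act (Transposition.transpose a b)"

lemma act_tr [simp]: "act (tr a b) = Transposition.transpose a b"
proof -
  have "{z. Transposition.transpose a b z \<noteq> z} \<subseteq> {a, b}" by (auto simp: Transposition.transpose_def)
  then have "finite {z. Transposition.transpose a b z \<noteq> z}" by (rule finite_subset) simp
  then have "Transposition.transpose a b \<in> range act" by (intro finitary bij_transpose)
  then show ?thesis by (simp add: tr_def f_inv_into_f)
qed

lemma moved_tr: "moved (tr a b) \<subseteq> {a, b}"
  by (auto simp: moved_def Transposition.transpose_def)

lemma tr_tr [simp]: "tr a b \<otimes> tr a b = \<one>"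
  by (rule act_eqI) (simp add: act_mult)

lemma inv_tr [simp]: "inv (tr a b) = tr a b"
  by (rule inv_equality) simp_all

lemma tr_conj: "g \<otimes> tr a b \<otimes> inv g = tr (act g a) (act g b)"
  by (rule act_eqI) (simp add: act_mult Transposition.transpose_def act_inv_eq_iff)

definition cyc :: "'x \<Rightarrow> 'x \<Rightarrow> 'x \<Rightarrow> 'g" where "cyc a b c = tr a b \<otimes> tr b c"

lemma act_cyc:
  "distinct [a, b, c] \<Longrightarrow> act (cyc a b c) z = (if z = a then b else if z = b then c else if z = c then a else z)"
  by (auto simp: cyc_def act_mult Transposition.transpose_def)

lemma cyc_conj: "g \<otimes> cyc a b c \<otimes> inv g = cyc (act g a) (act g b) (act g c)"
proof -
  have "g \<otimes> cyc a b c \<otimes> inv g = (g \<otimes> tr a b \<otimes> inv g) \<otimes> (g \<otimes> tr b c \<otimes> inv g)"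
    by (simp add: cyc_def m_assoc)
  then show ?thesis by (simp add: tr_conj cyc_def)
qed

lemma moved_cyc:
  assumes "distinct [a, b, c]" shows "moved (cyc a b c) = {a, b, c}"
proof -
  have "b \<noteq> a" "c \<noteq> b" "a \<noteq> c" using assms by auto
  then show ?thesis unfolding moved_def act_cyc[OF assms] by auto
qed

text \<open>Three transpositions correct the three images in turn, none disturbing the earlier ones.
  Together with \<open>cyc_conj\<close> this makes all 3-cycles conjugate, so they share the same
  coefficients.\<close>

lemma ex_act_triple:
  assumes "distinct [a, b, c]" "distinct [a', b', c']"
  shows "\<exists>k. act k a = a' \<and> act k b = b' \<and> act k c = c'"
proof -
  define k1 where "k1 = tr a a'"
  define k2 where "k2 = tr (act k1 b) b' \<otimes> k1"
  define k3 where "k3 = tr (act k2 c) c' \<otimes> k2"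
  have k1: "act k1 a = a'" by (simp add: k1_def)
  have "act k1 b \<noteq> a'" using assms(1) unfolding k1[symmetric] by auto
  then have k2: "act k2 a = a'" "act k2 b = b'" using assms by (auto simp: k2_def act_mult k1 Transposition.transpose_def)
  have "act k2 c \<noteq> a'" using assms(1) unfolding k2(1)[symmetric] by auto
  moreover have "act k2 c \<noteq> b'" using assms(1) unfolding k2(2)[symmetric] by auto
  ultimately have "act k3 a = a'" "act k3 b = b'" "act k3 c = c'"
    using assms by (auto simp: k3_def act_mult k2 Transposition.transpose_def)
  then show ?thesis by blast
qed

lemma ex_point_outside: "finite F \<Longrightarrow> \<exists>z. z \<notin> (F :: 'x set)"
  using infinite_points ex_new_if_finite by blast

lemma ex_distinct_triple: "\<exists>a b c :: 'x. distinct [a, b, c]"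
proof -
  obtain b where "b \<notin> {undefined :: 'x}" using ex_point_outside[of "{undefined}"] by blast
  moreover obtain c where "c \<notin> {undefined, b}" using ex_point_outside[of "{undefined, b}"] by blast
  ultimately have "distinct [undefined, b, c]" by auto
  then show ?thesis by blast
qed

text \<open>The conjugates are told apart by the point that they send to \<open>z\<close>.\<close>

lemma infinite_conjugates:
  assumes "infinite Q" "\<And>a. a \<in> Q \<Longrightarrow> h a \<in> A" "\<And>a. a \<in> Q \<Longrightarrow> act (h a \<otimes> x \<otimes> inv (h a)) a = z"
  shows "infinite ((\<lambda>h. h \<otimes> x \<otimes> inv h) ` A)"
proof -
  have "inj_on (\<lambda>a. h a \<otimes> x \<otimes> inv (h a)) Q"
    by (rule inj_onI) (metis assms(3) act_inj)
  then have "infinite ((\<lambda>a. h a \<otimes> x \<otimes> inv (h a)) ` Q)"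
    using assms(1) finite_imageD by blast
  moreover have "(\<lambda>a. h a \<otimes> x \<otimes> inv (h a)) ` Q \<subseteq> (\<lambda>h. h \<otimes> x \<otimes> inv h) ` A"
    using assms(2) by blast
  ultimately show ?thesis using finite_subset by blast
qed

end

section \<open>The vectors of 3-cycles and the three resulting cases\<close>

locale finitary_invariant_algebra = finitary_extension G act + invariant_algebra G P
  for G :: "'g monoid" (structure) and act :: "'g \<Rightarrow> 'x \<Rightarrow> 'x" and P
begin

text \<open>If \<open>x\<close> moves a point \<open>y\<close> that \<open>g\<close> fixes, the
  transpositions of \<open>y\<close> with further fixed points \<open>w\<close> of \<open>g\<close>
  commute with \<open>g\<close>. Conjugating \<open>x\<close> by them gives infinitely many
  elements, since the conjugate sends \<open>w\<close> to \<open>act x y\<close>.\<close>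

lemma support_v:
  assumes fin: "finite (moved g)" and nz: "coord (v g) x \<noteq> 0"
  shows "moved x \<subseteq> moved g"
proof (rule ccontr)
  assume "\<not> moved x \<subseteq> moved g"
  then obtain y where y: "y \<in> moved x" "y \<notin> moved g" by blast
  define z where "z = act x y"
  have zy: "z \<noteq> y" using y(1) by (simp add: z_def moved_def)
  define A where "A = {h. moved g \<inter> moved h = {}}"
  have "C h (v g) = v g" if "h \<in> A" for h
  proof -
    have "h \<otimes> g \<otimes> inv h = g"
      using commute_if_disjoint[of g h] that by (simp add: A_def inv_solve)
    then show ?thesis using v_conjugate[of h g] by simp
  qed
  moreover have "infinite ((\<lambda>h. h \<otimes> x \<otimes> inv h) ` A)"
  proof (rule infinite_conjugates[where h = "tr y" and z = z])
    show "infinite (- (moved g \<union> {y, z}))"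
      using fin infinite_points by (simp add: Compl_eq_Diff_UNIV)
    fix w assume w: "w \<in> - (moved g \<union> {y, z})"
    show "tr y w \<in> A"
      using moved_tr[of y w] w y(2) by (auto simp: A_def)
    show "act (tr y w \<otimes> x \<otimes> inv (tr y w)) w = z"
      using w zy by (auto simp: act_mult z_def[symmetric] Transposition.transpose_def)
  qed
  ultimately have "coord (v g) x = 0" by (rule coord_zero_of_infinite_orbit)
  with nz show False by contradiction
qed

text \<open>\<open>support_v\<close>, used in both directions through
  \<open>coord_v_commute\<close>, shows that \<open>x\<close> moves exactly the points of the cycle.
  A permutation of three points without fixed point is one of the two 3-cycles.\<close>

lemma support_v_cyc:
  assumes d: "distinct [a, b, c]" and nz: "coord (v (cyc a b c)) x \<noteq> 0"
  shows "x = cyc a b c \<or> x = cyc a c b"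
proof -
  have "moved x \<subseteq> {a, b, c}"
    using support_v[OF _ nz] moved_cyc[OF d] by simp
  moreover have "coord (v x) (cyc a b c) \<noteq> 0"
    using nz coord_v_commute[of x "cyc a b c"] by simp
  then have "moved (cyc a b c) \<subseteq> moved x"
    using \<open>moved x \<subseteq> {a, b, c}\<close> by (intro support_v) (auto intro: finite_subset)
  ultimately have m: "moved x = {a, b, c}" using moved_cyc[OF d] by auto
  have fixed: "act x z = z" if "z \<notin> {a, b, c}" for z
    using that unfolding m[symmetric] by (simp add: moved_def)
  have "act x z \<in> {a, b, c} - {z}" if "z \<in> {a, b, c}" for z
    using act_moved[of z x] that unfolding m[symmetric] by (simp add: moved_def)
  from this[of a] this[of b] this[of c]
  have "act x a = b \<or> act x a = c" "act x b = a \<or> act x b = c" "act x c = a \<or> act x c = b"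
    by auto
  moreover have "act x a \<noteq> act x b" "act x a \<noteq> act x c" "act x b \<noteq> act x c" using d by auto
  ultimately consider "act x a = b" "act x b = c" "act x c = a" | "act x a = c" "act x b = a" "act x c = b"
    by metis
  then show ?thesis
  proof cases
    case 1
    then have "act x z = act (cyc a b c) z" for z
      by (cases "z \<in> {a, b, c}") (auto simp: act_cyc[OF d] fixed)
    then have "x = cyc a b c" by (rule act_eqI)
    then show ?thesis ..
  next
    case 2
    have d': "distinct [a, c, b]" using d by auto
    from 2 have "act x z = act (cyc a c b) z" for z
      by (cases "z \<in> {a, b, c}") (auto simp: act_cyc[OF d'] fixed)
    then have "x = cyc a c b" by (rule act_eqI)
    then show ?thesis ..
  qed
qed

lemma cyc_noteq: "distinct [a, b, c] \<Longrightarrow> cyc a b c \<noteq> cyc a c b"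
  by (auto dest!: arg_cong[where f = "\<lambda>g. act g a"] simp: act_cyc)

lemma v_cyc_form:
  obtains \<alpha> \<beta> where
    "\<And>a b c. distinct [a, b, c] \<Longrightarrow> v (cyc a b c) = cscale \<alpha> (ket (cyc a b c)) + cscale \<beta> (ket (cyc a c b))"
proof -
  obtain a0 b0 c0 :: 'x where d0: "distinct [a0, b0, c0]" using ex_distinct_triple by blast
  define \<alpha> \<beta> where "\<alpha> = coord (v (cyc a0 b0 c0)) (cyc a0 b0 c0)"
    and "\<beta> = coord (v (cyc a0 b0 c0)) (cyc a0 c0 b0)"
  show ?thesis
  proof (rule that[of \<alpha> \<beta>], rule l2_eqI)
    fix a b c x assume d: "distinct [a, b, c :: 'x]"
    obtain k where k: "act k a0 = a" "act k b0 = b" "act k c0 = c"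
      using ex_act_triple[OF d0 d] by blast
    have "coord (v (cyc a b c)) (cyc a b c) = \<alpha>" "coord (v (cyc a b c)) (cyc a c b) = \<beta>"
      using coord_v_conjugate[of k "cyc a0 b0 c0" "cyc a0 b0 c0"]
        coord_v_conjugate[of k "cyc a0 b0 c0" "cyc a0 c0 b0"]
      unfolding cyc_conj k \<alpha>_def \<beta>_def .
    then show "coord (v (cyc a b c)) x = coord (cscale \<alpha> (ket (cyc a b c)) + cscale \<beta> (ket (cyc a c b))) x"
      using support_v_cyc[OF d, of x] cyc_noteq[OF d] by (auto simp: coord_ket)
  qed
qed

text \<open>On the span of a 3-cycle and its inverse \<open>proj K\<close> has the matrix with
  diagonal entries \<open>\<alpha>\<close> and off-diagonal entries \<open>\<beta>\<close>.
  Idempotency leaves 0, the identity, or \<open>\<alpha> = 1/2\<close>; in the last case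
  \<open>\<epsilon>\<close> is \<open>2 * \<beta>\<close>.\<close>

lemma cyc_coefficients:
  obtains (zero) "\<And>a b c. distinct [a, b, c] \<Longrightarrow> v (cyc a b c) = 0"
    | (one) "\<And>a b c. distinct [a, b, c] \<Longrightarrow> v (cyc a b c) = ket (cyc a b c)"
    | (half) \<epsilon> where "\<epsilon> \<noteq> 0" "\<And>a b c. distinct [a, b, c] \<Longrightarrow>
        v (cyc a b c) = cscale (1/2) (ket (cyc a b c) + cscale \<epsilon> (ket (cyc a c b)))"
proof -
  obtain \<alpha> \<beta> where form:
    "\<And>a b c. distinct [a, b, c] \<Longrightarrow> v (cyc a b c) = cscale \<alpha> (ket (cyc a b c)) + cscale \<beta> (ket (cyc a c b))"
    using v_cyc_form by blast
  obtain a b c :: 'x where d: "distinct [a, b, c]" using ex_distinct_triple by blast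
  have d': "distinct [a, c, b]" using d by auto
  have "v (cyc a b c) = proj K (v (cyc a b c))" by (simp add: v_def K.proj_id K.proj_in)
  also have "\<dots> = cscale \<alpha> (v (cyc a b c)) + cscale \<beta> (v (cyc a c b))"
    by (subst form[OF d]) (simp only: v_def bounded_clinearD[OF bounded_clinear_proj_K])
  finally have idem: "v (cyc a b c) = cscale \<alpha> (v (cyc a b c)) + cscale \<beta> (v (cyc a c b))" .
  have "coord (v (cyc a b c)) x = \<alpha> * coord (v (cyc a b c)) x + \<beta> * coord (v (cyc a c b)) x" for x
    by (subst idem) simp
  from this[of "cyc a b c"] this[of "cyc a c b"]
  have eqs: "\<alpha> = \<alpha> * \<alpha> + \<beta> * \<beta>" "\<beta> = \<alpha> * \<beta> + \<beta> * \<alpha>"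
    using cyc_noteq[OF d] cyc_noteq[OF d'] by (simp_all add: form[OF d] form[OF d'] coord_ket)
  have scale0: "cscale 0 \<xi> = 0" "cscale 1 \<xi> = \<xi>" for \<xi> :: "'g l2" by (rule l2_eqI; simp)+
  show ?thesis
  proof (cases "\<beta> = 0")
    case True
    then have "\<alpha> = 0 \<or> \<alpha> = 1" using eqs(1) by auto
    then show ?thesis
    proof
      assume "\<alpha> = 0"
      then show ?thesis using zero form \<open>\<beta> = 0\<close> by (simp add: scale0)
    next
      assume "\<alpha> = 1"
      then show ?thesis using one form \<open>\<beta> = 0\<close> by (simp add: scale0)
    qed
  next
    case False
    have "\<beta> * (1 - 2 * \<alpha>) = 0" using eqs(2) by (simp add: algebra_simps)
    then have "1 - 2 * \<alpha> = 0" using False by simp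
    then have \<alpha>: "\<alpha> = 1/2" by (simp add: field_simps)
    show ?thesis
      by (rule half[of "2 * \<beta>"]) (use False form in \<open>auto simp: \<alpha> cscale_add cscale_cscale\<close>)
  qed
qed

text \<open>Here \<open>P\<close> contains the sum of a 3-cycle and \<open>\<epsilon>\<close> times
  its inverse, as an operator. The product of two such sums for cycles sharing two points contains a
  third 3-cycle but not its inverse, whereas in \<open>K\<close> the coefficient at the inverse
  would have to account for half of the other one.\<close>

lemma cyc_not_half:
  assumes \<epsilon>: "\<epsilon> \<noteq> 0" and half: "\<And>a b c. distinct [a, b, c] \<Longrightarrow>
    v (cyc a b c) = cscale (1/2) (ket (cyc a b c) + cscale \<epsilon> (ket (cyc a c b)))"
  shows False
proof -
  obtain a b c :: 'x where "distinct [a, b, c]" using ex_distinct_triple by blast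
  moreover obtain d where "d \<notin> {a, b, c}" using ex_point_outside[of "{a, b, c}"] by blast
  ultimately have dist: "a \<noteq> b" "a \<noteq> c" "a \<noteq> d" "b \<noteq> c" "b \<noteq> d" "c \<noteq> d"
    "b \<noteq> a" "c \<noteq> a" "d \<noteq> a" "c \<noteq> b" "d \<noteq> b" "d \<noteq> c" by auto
  define S where "S x y z \<xi> = L (cyc x y z) \<xi> + cscale \<epsilon> (L (cyc x z y) \<xi>)" for x y z \<xi>
  have S: "S x y z \<in> ops" if "distinct [x, y, z]" for x y z
  proof (rule in_ops_if_ket_in_K)
    show "S x y z \<in> RC" unfolding S_def by (intro RC_add RC_cscale RC_L)
    have "S x y z (ket \<one>) = cscale 2 (v (cyc x y z))"
      by (simp add: S_def half[OF that] cscale_cscale) (rule l2_eqI, simp)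
    then show "S x y z (ket \<one>) \<in> K" using csubspace_K v_in_K by (simp add: csubspace_def)
  qed
  define \<xi> where "\<xi> = S a b c (S a b d (ket \<one>))"
  have "\<xi> \<in> K"
    unfolding \<xi>_def using dist by (intro ops_in_K[OF ops_mult] S) auto
  have \<xi>: "\<xi> = ket (cyc a b c \<otimes> cyc a b d) + cscale \<epsilon> (ket (cyc a b c \<otimes> cyc a d b))
      + cscale \<epsilon> (ket (cyc a c b \<otimes> cyc a b d) + cscale \<epsilon> (ket (cyc a c b \<otimes> cyc a d b)))"
    by (simp add: \<xi>_def S_def bounded_clinearD[OF bounded_clinear_translations(1)])
  have ne: "g \<noteq> h" if "act g z \<noteq> act h z" for g h z using that by blast
  have cyc: "act (cyc x y z) w = (if w = x then y else if w = y then z else if w = z then x else w)"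
    if "x \<noteq> y" "x \<noteq> z" "y \<noteq> z" for x y z w
    using that by (simp add: act_cyc)
  \<comment> \<open>The point \<open>b\<close> drops out. The other three products are two double
    transpositions and a 3-cycle on \<open>b\<close>, \<open>c\<close>, \<open>d\<close>, so they do
    not interfere.\<close>
  have prod: "cyc a b c \<otimes> cyc a d b = cyc a d c"
    by (rule act_eqI) (auto simp: act_mult cyc dist)
  have nes: "cyc a b c \<otimes> cyc a b d \<noteq> cyc a d c" "cyc a c b \<otimes> cyc a b d \<noteq> cyc a d c"
      "cyc a c b \<otimes> cyc a d b \<noteq> cyc a d c" "cyc a b c \<otimes> cyc a b d \<noteq> cyc a c d"
      "cyc a c b \<otimes> cyc a b d \<noteq> cyc a c d" "cyc a c b \<otimes> cyc a d b \<noteq> cyc a c d"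
      "cyc a d c \<noteq> cyc a c d"
    by (rule ne[of _ a] ne[of _ c] ne[of _ d], simp add: act_mult cyc dist)+
  have "coord \<xi> (cyc a d c) = \<epsilon>" "coord \<xi> (cyc a c d) = 0"
    using nes by (auto simp: \<xi> coord_ket prod)
  moreover have "coord \<xi> (cyc a d c) = 1/2 * (coord \<xi> (cyc a d c) + cnj \<epsilon> * coord \<xi> (cyc a c d))"
  proof -
    have "coord \<xi> (cyc a d c) = cip \<xi> (cscale (1/2) (ket (cyc a d c) + cscale \<epsilon> (ket (cyc a c d))))"
      unfolding coord_K[OF \<open>\<xi> \<in> K\<close>, of "cyc a d c"] using dist by (subst half) auto
    then show ?thesis by (simp add: cip_cscale_right cip_add_right)
  qed
  ultimately show False using \<epsilon> by simp
qed

text \<open>For a 3-cycle \<open>s\<close>, both \<open>s\<close> and its conjugate by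
  \<open>g\<close> lie in the algebra. The bimodule property then makes
  \<open>L (inv g) (v g)\<close> invariant under conjugation by \<open>s\<close>, and every element
  other than \<open>\<one>\<close> has infinitely many conjugates by 3-cycles.\<close>

lemma v_of_cyc_one:
  assumes one: "\<And>a b c. distinct [a, b, c] \<Longrightarrow> v (cyc a b c) = ket (cyc a b c)"
  shows "v g = 0 \<or> v g = ket g"
proof -
  have L_cyc: "L (cyc a b c) \<in> ops" if "distinct [a, b, c]" for a b c
    using in_ops_if_ket_in_K[OF RC_L, of "cyc a b c"] v_in_K[of "cyc a b c"] one[OF that] by simp
  define \<xi> where "\<xi> = L (inv g) (v g)"
  have C_\<xi>: "C (cyc a b c) \<xi> = \<xi>" if d: "distinct [a, b, c]" for a b c
  proof -
    let ?s = "cyc a b c"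
    let ?s' = "g \<otimes> ?s \<otimes> inv g"
    have s': "L ?s' \<in> ops" unfolding cyc_conj using d by (intro L_cyc) auto
    have "C ?s \<xi> = L (inv g) (R ?s (L ?s' (v g)))"
      by (simp add: \<xi>_def translation_compose m_assoc)
    also have "L ?s' (v g) = v (g \<otimes> ?s)"
      using proj_mult(1)[OF s', of g] by (simp add: m_assoc)
    also have "R ?s (v (g \<otimes> ?s)) = v g"
      unfolding proj_mult(2)[OF L_cyc[OF d]] by (simp add: translation_compose)
    finally show ?thesis by (simp add: \<xi>_def)
  qed
  have "coord \<xi> w = 0" if w: "w \<noteq> \<one>" for w
  proof -
    obtain y where y: "act w y \<noteq> y" using moved_empty[of w] w by (auto simp: moved_def)
    define z where "z = act w y"
    obtain b where b: "b \<notin> {y, z}" using ex_point_outside[of "{y, z}"] by blast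
    show ?thesis
    proof (rule coord_zero_of_infinite_orbit)
      show "C h \<xi> = \<xi>" if "h \<in> {cyc a b c |a b c. distinct [a, b, c]}" for h
        using that C_\<xi> by blast
      show "infinite ((\<lambda>h. h \<otimes> w \<otimes> inv h) ` {cyc a b c |a b c. distinct [a, b, c]})"
      \<comment> \<open>The cycle takes \<open>y\<close> to \<open>a\<close> and fixes
        \<open>z\<close>, so the conjugate of \<open>w\<close> sends the varying point
        \<open>a\<close> to the fixed target \<open>z\<close>.\<close>
      proof (rule infinite_conjugates[where h = "\<lambda>a. cyc y a b" and z = z])
        show "infinite (- {y, z, b})" using infinite_points by (simp add: Compl_eq_Diff_UNIV)
        fix a assume a: "a \<in> - {y, z, b}"
        have d: "distinct [y, a, b]" using a b by auto
        then show "cyc y a b \<in> {cyc a b c |a b c. distinct [a, b, c]}" by blast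
        have "act (inv (cyc y a b)) a = y" unfolding act_inv_eq_iff by (simp add: act_cyc[OF d])
        moreover have "act (cyc y a b) z = z" unfolding act_cyc[OF d] using a b y by (auto simp: z_def)
        ultimately show "act (cyc y a b \<otimes> w \<otimes> inv (cyc y a b)) a = z"
          by (simp add: act_mult z_def[symmetric])
      qed
    qed
  qed
  then have off: "coord (v g) x = 0" if "x \<noteq> g" for x
  proof -
    have "inv g \<otimes> x \<noteq> \<one>" using that by (simp add: inv_solve)
    moreover have "coord \<xi> (inv g \<otimes> x) = coord (v g) x" by (simp add: \<xi>_def)
    ultimately show ?thesis using \<open>\<And>w. w \<noteq> \<one> \<Longrightarrow> coord \<xi> w = 0\<close> by metis
  qed
  define c where "c = coord (v g) g"
  have v: "v g = cscale c (ket g)"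
    using off by (intro l2_eqI) (auto simp: c_def coord_ket)
  have "v g = proj K (v g)" by (simp add: v_def K.proj_id K.proj_in)
  also have "\<dots> = cscale c (v g)" by (subst v) (simp add: v_def bounded_clinearD[OF bounded_clinear_proj_K])
  finally have "coord (v g) g = c * coord (v g) g" by (metis coord_cscale)
  then have "c = 0 \<or> c = 1" by (simp add: c_def)
  moreover have "cscale 0 (ket g) = 0" "cscale 1 (ket g) = ket g" by (rule l2_eqI; simp)+
  ultimately show ?thesis using v by auto
qed

text \<open>
  For \<open>h q = tr p q \<otimes> g \<otimes> inv (tr p q)\<close> the element \<open>h q \<otimes> inv (h q')\<close> is a 3-cycle if \<open>g\<close> is
  finitary and \<open>q\<close>, \<open>q'\<close> are fixed by \<open>g\<close>; in general it is finitary and not \<open>\<one>\<close>.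
\<close>

lemma v_of_cyc_zero:
  assumes zero: "\<And>a b c. distinct [a, b, c] \<Longrightarrow> v (cyc a b c) = 0" and g: "g \<noteq> \<one>"
  shows "v g = 0"
proof -
  have ex: "\<exists>p. act h p \<noteq> p" if "h \<noteq> \<one>" for h
    using moved_empty[of h] that by (auto simp: moved_def)
  \<comment> \<open>The two inner transpositions are carried along by \<open>h\<close>, which itself
    cancels. The quotient is a product of four transpositions whatever \<open>h\<close> is, hence
    always finitary.\<close>
  have conj: "(tr p q \<otimes> h \<otimes> inv (tr p q)) \<otimes> inv (tr p q' \<otimes> h \<otimes> inv (tr p q'))
      = tr p q \<otimes> tr (act h p) (act h q) \<otimes> tr (act h p) (act h q') \<otimes> tr p q'" for h :: 'g and p q q' :: 'x
  proof -
    have "(tr p q \<otimes> h \<otimes> inv (tr p q)) \<otimes> inv (tr p q' \<otimes> h \<otimes> inv (tr p q'))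
        = tr p q \<otimes> (h \<otimes> tr p q \<otimes> inv h) \<otimes> (h \<otimes> tr p q' \<otimes> inv h) \<otimes> tr p q'"
      by (simp add: m_assoc inv_mult_group)
    then show ?thesis by (simp only: tr_conj)
  qed
  have fin_case: "v h = 0" if fin: "finite (moved h)" and h: "h \<noteq> \<one>" for h
  proof -
    obtain p where p: "act h p \<noteq> p" using ex h by blast
    define r where "r = act h p"
    have r: "r \<in> moved h" using act_moved[of p h] p by (simp add: r_def moved_def)
    show ?thesis
    proof (rule v_zero_of_infinite_family[where k = "tr p"])
      show "infinite (- moved h)" using fin infinite_points by (simp add: Compl_eq_Diff_UNIV)
      fix q q' assume q: "q \<in> - moved h" "q' \<in> - moved h" "q \<noteq> q'"
      then have ne: "p \<noteq> q" "p \<noteq> q'" "r \<noteq> q" "r \<noteq> q'" "p \<noteq> r"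
        using p r by (auto simp: moved_def r_def)
      have "act h q = q" "act h q' = q'" using q by (auto simp: moved_def)
      then have "(tr p q \<otimes> h \<otimes> inv (tr p q)) \<otimes> inv (tr p q' \<otimes> h \<otimes> inv (tr p q'))
          = tr p q \<otimes> tr r q \<otimes> tr r q' \<otimes> tr p q'"
        unfolding conj r_def by simp
      also have "\<dots> = cyc q' q r"
      proof (rule act_eqI)
        have "distinct [q', q, r]" using ne q by auto
        then show "act (tr p q \<otimes> tr r q \<otimes> tr r q' \<otimes> tr p q') z = act (cyc q' q r) z" for z
          using ne q(3) by (simp add: act_cyc act_mult) (auto simp: Transposition.transpose_def)
      qed
      finally show "v ((tr p q \<otimes> h \<otimes> inv (tr p q)) \<otimes> inv (tr p q' \<otimes> h \<otimes> inv (tr p q'))) = 0"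
        using zero[of q' q r] ne q(3) by auto
    qed simp
  qed
  obtain p where p: "act g p \<noteq> p" using ex g by blast
  show ?thesis
  proof (rule v_zero_of_infinite_family[where k = "tr p"])
    show "infinite (- {p, act g p})" using infinite_points by (simp add: Compl_eq_Diff_UNIV)
    fix q q' assume q: "q \<in> - {p, act g p}" "q' \<in> - {p, act g p}" "q \<noteq> q'"
    let ?h = "\<lambda>q. tr p q \<otimes> g \<otimes> inv (tr p q)"
    show "v (?h q \<otimes> inv (?h q')) = 0"
    proof (rule fin_case)
      have "moved (?h q \<otimes> inv (?h q')) \<subseteq> {p, q, act g p, act g q, q', act g q'}"
        unfolding conj using moved_mult moved_tr by (blast dest: subsetD)
      then show "finite (moved (?h q \<otimes> inv (?h q')))" by (rule finite_subset) simp
      \<comment> \<open>The two conjugates reach the same point \<open>act g p\<close> from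
        different points, so they differ.\<close>
      have "act (?h q) q = act g p" "act (?h q') q' = act g p"
        using q p by (auto simp: act_mult Transposition.transpose_def)
      then have "?h q \<noteq> ?h q'" using q(3) by (metis act_inj)
      then show "?h q \<otimes> inv (?h q') \<noteq> \<one>" using inv_solve(2)[of "?h q" "?h q'" \<one>] by simp
    qed
  qed simp
qed

lemma P_is_subgroup_algebra: "\<exists>H. H \<lhd> G \<and> P = group_vn_algebra G H"
proof (rule P_eq_group_vn_algebra)
  fix g show "v g = 0 \<or> v g = ket g"
  proof (cases rule: cyc_coefficients)
    case zero
    then show ?thesis using v_of_cyc_zero[of g] v_one by (cases "g = \<one>") auto
  next
    case one
    then show ?thesis by (rule v_of_cyc_one)
  next
    case (half \<epsilon>)
    then show ?thesis using cyc_not_half by blast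
  qed
qed

end

theorem (in finitary_extension) ISR_property: "ISR_property G"
  unfolding ISR_property_def
proof (intro allI impI)
  fix P assume "invariant_vn_subalgebra G P"
  then interpret finitary_invariant_algebra G act P by unfold_locales
  show "\<exists>H. H \<lhd> G \<and> P = group_vn_algebra G H" by (rule P_is_subgroup_algebra)
qed

section \<open>Amenability\<close>

lemma compact_unit_functions: "compact {m :: 'a \<Rightarrow> real. \<forall>A. 0 \<le> m A \<and> m A \<le> 1}"
proof -
  have "compactin (product_topology (\<lambda>_ :: 'a. euclidean) UNIV) (PiE UNIV (\<lambda>_. {0..1 :: real}))"
    by (simp add: compactin_PiE compactin_euclidean_iff)
  then show ?thesis
    unfolding euclidean_product_topology compactin_euclidean_iff
    by (simp add: PiE_def Pi_def extensional_def atLeastAtMost_def)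
qed

text \<open>The set \<open>M n\<close> of additive functions normalized on \<open>H\<close> and
  invariant under \<open>F n\<close> is closed in the product topology, because each condition
  involves finitely many values. These sets decrease and each has a point in the compact cube, so a
  common point exists.\<close>

lemma amenable_increasing_union_finite:
  fixes G (structure)
  assumes G: "group G" and F: "\<And>n. subgroup (F n) G" "\<And>n. finite (F n)" "incseq F"
    and H: "H = (\<Union>n :: nat. F n)"
  shows "amenable (G\<lparr>carrier := H\<rparr>)"
proof -
  interpret group G by fact
  define M where "M n = {m :: 'a set \<Rightarrow> real. (\<forall>A B. A \<inter> B = {} \<longrightarrow> m (A \<union> B) = m A + m B) \<and> m H = 1 \<and>
    (\<forall>g\<in>F n. \<forall>A. A \<subseteq> H \<longrightarrow> m (g <# A) = m A)}" for n
  have F_sub: "F n \<subseteq> F k" if "n \<le> k" for n k using F(3) that by (simp add: incseq_def)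
  have F_H: "F n \<subseteq> H" for n using H by blast
  have H_carrier: "H \<subseteq> carrier G" using F(1) subgroup.subset H by blast
  have closed: "closed (M n)" for n
    unfolding M_def Ball_def
    by (intro closed_Collect_conj closed_Collect_all closed_Collect_imp open_Collect_const
        closed_Collect_eq continuous_on_add continuous_on_const continuous_on_product_coordinates)
  have ex: "\<exists>m. m \<in> {m. \<forall>A. 0 \<le> m A \<and> m A \<le> 1} \<and> m \<in> M n" for n
  proof (intro exI conjI)
    \<comment> \<open>Normalized counting on \<open>F n\<close>, which translations by its own
      elements permute.\<close>
    define m where "m A = real (card (A \<inter> F n)) / real (card (F n))" for A
    have c: "card (F n) > 0"
      using F(1,2)[of n] subgroup.one_closed by (auto simp: card_gt_0_iff)
    show "m \<in> {m. \<forall>A. 0 \<le> m A \<and> m A \<le> 1}"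
      using c F(2) by (auto simp: m_def divide_le_eq intro: card_mono)
    show "m \<in> M n"
      unfolding M_def mem_Collect_eq
    proof (intro conjI allI impI ballI)
      show "m (A \<union> B) = m A + m B" if "A \<inter> B = {}" for A B
      proof -
        have "card ((A \<union> B) \<inter> F n) = card (A \<inter> F n) + card (B \<inter> F n)"
          unfolding Int_Un_distrib2 using that F(2) by (intro card_Un_disjoint) auto
        then show ?thesis by (simp add: m_def add_divide_distrib)
      qed
      show "m H = 1" using c F_H[of n] by (simp add: m_def Int_absorb1)
      fix g A assume g: "g \<in> F n" and A: "A \<subseteq> H"
      have sub: "F n \<subseteq> carrier G" by (rule subgroup.subset[OF F(1)])
      have "(g <# A) \<inter> F n = (\<lambda>a. g \<otimes> a) ` (A \<inter> F n)"
      proof (intro equalityI subsetI)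
        fix x assume "x \<in> (g <# A) \<inter> F n"
        then obtain a where a: "a \<in> A" "x = g \<otimes> a" "x \<in> F n" by (auto simp: l_coset_def)
        have "inv g \<otimes> x \<in> F n"
          using g a(3) F(1) by (intro subgroup.m_closed[OF F(1)] subgroup.m_inv_closed[OF F(1)])
        moreover have "inv g \<otimes> x = a" using a A H_carrier g sub by (simp add: subset_iff flip: m_assoc)
        ultimately show "x \<in> (\<lambda>a. g \<otimes> a) ` (A \<inter> F n)" using a by blast
      next
        fix x assume "x \<in> (\<lambda>a. g \<otimes> a) ` (A \<inter> F n)"
        then show "x \<in> (g <# A) \<inter> F n"
          using g subgroup.m_closed[OF F(1)] by (auto simp: l_coset_def)
      qed
      moreover have "inj_on (\<lambda>a. g \<otimes> a) (A \<inter> F n)"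
        using g sub by (intro inj_onI) (auto simp: subset_iff)
      ultimately show "m (g <# A) = m A" by (simp add: m_def card_image)
    qed
  qed
  have "{m. \<forall>A. 0 \<le> m A \<and> m A \<le> 1} \<inter> \<Inter> (M ` UNIV) \<noteq> {}"
  proof (rule compact_imp_fip_image[OF compact_unit_functions])
    fix I :: "nat set" assume "finite I"
    then have "M (Max (insert 0 I)) \<subseteq> M n" if "n \<in> I" for n
      using F_sub[of n "Max (insert 0 I)"] that unfolding M_def by fastforce
    then show "{m. \<forall>A. 0 \<le> m A \<and> m A \<le> 1} \<inter> \<Inter> (M ` I) \<noteq> {}"
      using ex[of "Max (insert 0 I)"] by blast
  qed (rule closed)
  then obtain m where m: "\<And>A. 0 \<le> m A" "\<And>n. m \<in> M n" by blast
  have cos: "g <#\<^bsub>G\<lparr>carrier := H\<rparr>\<^esub> A = g <# A" for g A by (simp add: l_coset_def)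
  have inv: "m (g <# A) = m A" if "g \<in> H" "A \<subseteq> H" for g A
  proof -
    obtain n where "g \<in> F n" using \<open>g \<in> H\<close> H by blast
    then show ?thesis using m(2)[of n] that(2) by (simp add: M_def)
  qed
  have "m H = 1" "\<And>A B. A \<inter> B = {} \<Longrightarrow> m (A \<union> B) = m A + m B" using m(2)[of 0] by (simp_all add: M_def)
  with m(1) inv show ?thesis unfolding amenable_def cos by (intro exI[of _ m]) simp
qed

text \<open>\<open>h i\<close> carries the complement of \<open>Y i\<close> into \<open>Y i\<close>,
  so each \<open>Y i\<close> has mean at least 1/2. With two sets there is no contradiction: the
  infinite dihedral group, with words sorted by their first letter, is amenable.\<close>

lemma not_amenable_of_three_halves:
  fixes G (structure)
  assumes G: "group G" and N: "subgroup N G"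
    and am: "amenable (G\<lparr>carrier := N\<rparr>)"
    and Y: "\<And>i. i < (3 :: nat) \<Longrightarrow> Y i \<subseteq> N" "\<And>i j. i < 3 \<Longrightarrow> j < 3 \<Longrightarrow> i \<noteq> j \<Longrightarrow> Y i \<inter> Y j = {}"
    and h: "\<And>i. i < 3 \<Longrightarrow> h i \<in> N" "\<And>i k. i < 3 \<Longrightarrow> k \<in> N - Y i \<Longrightarrow> h i \<otimes> k \<in> Y i"
  shows False
proof -
  obtain m where m: "\<And>A. A \<subseteq> N \<Longrightarrow> 0 \<le> m A" "m N = 1"
    "\<And>A B. A \<subseteq> N \<Longrightarrow> B \<subseteq> N \<Longrightarrow> A \<inter> B = {} \<Longrightarrow> m (A \<union> B) = m A + (m B :: real)"
    "\<And>g A. g \<in> N \<Longrightarrow> A \<subseteq> N \<Longrightarrow> m (g <# A) = m A"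
  proof -
    have cos: "g <#\<^bsub>G\<lparr>carrier := N\<rparr>\<^esub> A = g <# A" for g A by (simp add: l_coset_def)
    obtain m :: "'a set \<Rightarrow> real" where "(\<forall>A. A \<subseteq> N \<longrightarrow> 0 \<le> m A) \<and> m N = 1 \<and>
        (\<forall>A B. A \<subseteq> N \<and> B \<subseteq> N \<and> A \<inter> B = {} \<longrightarrow> m (A \<union> B) = m A + m B) \<and>
        (\<forall>g A. g \<in> N \<and> A \<subseteq> N \<longrightarrow> m (g <# A) = m A)"
      using am unfolding amenable_def cos by (elim exE) simp
    then show ?thesis by (intro that[of m]) blast+
  qed
  have mono: "m A \<le> m B" if "A \<subseteq> B" "B \<subseteq> N" for A B
  proof -
    have "m (A \<union> (B - A)) = m A + m (B - A)" using that by (intro m(3)) auto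
    moreover have "A \<union> (B - A) = B" using that by auto
    ultimately show ?thesis using m(1)[of "B - A"] that by auto
  qed
  have half: "m (Y i) \<ge> 1/2" if i: "i < 3" for i
  proof -
    have "1 = m (Y i) + m (N - Y i)"
      using m(3)[of "Y i" "N - Y i"] Y(1)[OF i] m(2) by (simp add: Un_absorb1)
    moreover have "m (N - Y i) = m (h i <# (N - Y i))" using h(1)[OF i] by (intro m(4)[symmetric]) auto
    moreover have "m (h i <# (N - Y i)) \<le> m (Y i)"
      using h(2)[OF i] Y(1)[OF i] by (intro mono) (auto simp: l_coset_def)
    ultimately show ?thesis by simp
  qed
  have Y3: "Y 0 \<subseteq> N" "Y 1 \<subseteq> N" "Y 2 \<subseteq> N" "Y 0 \<inter> Y 1 = {}" "(Y 0 \<union> Y 1) \<inter> Y 2 = {}"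
    using Y(1)[of 0] Y(1)[of 1] Y(1)[of 2] Y(2)[of 0 1] Y(2)[of 0 2] Y(2)[of 1 2] by auto
  have "m (Y 0 \<union> Y 1 \<union> Y 2) = m (Y 0) + m (Y 1) + m (Y 2)"
    using Y3 by (simp add: m(3))
  moreover have "m (Y 0 \<union> Y 1 \<union> Y 2) \<le> 1" using mono[of "Y 0 \<union> Y 1 \<union> Y 2" N] Y3 m(2) by auto
  ultimately show False using half[of 0] half[of 1] half[of 2] by simp
qed

section \<open>The normal amenable subgroup of finitary permutations\<close>

context finitary_extension
begin

definition R_fin :: "'g set" where "R_fin = {g. finite (moved g)}"

lemma subgroup_R_fin: "subgroup R_fin G"
proof
  show "x \<otimes> y \<in> R_fin" if "x \<in> R_fin" "y \<in> R_fin" for x y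
    using that moved_mult[of x y] finite_subset unfolding R_fin_def by blast
qed (auto simp: R_fin_def moved_def[of \<one>])

lemma normal_R_fin: "R_fin \<lhd> G"
  unfolding normal_inv_iff
proof (intro conjI ballI subgroup_R_fin)
  fix x h assume "h \<in> R_fin"
  have "moved (x \<otimes> h \<otimes> inv x) \<subseteq> act x ` moved h"
  proof
    fix z assume "z \<in> moved (x \<otimes> h \<otimes> inv x)"
    then have "act (inv x) z \<in> moved h" by (auto simp: moved_def act_mult)
    then have "act x (act (inv x) z) \<in> act x ` moved h" by (rule imageI)
    then show "z \<in> act x ` moved h" by simp
  qed
  then show "x \<otimes> h \<otimes> inv x \<in> R_fin"
    using \<open>h \<in> R_fin\<close> by (auto simp: R_fin_def intro: finite_subset)
qed

lemma R_fin_nontrivial: "R_fin \<noteq> {\<one>}"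
proof -
  obtain a b c :: 'x where d: "distinct [a, b, c]" using ex_distinct_triple by blast
  have "moved (cyc a b c) = {a, b, c}" by (rule moved_cyc[OF d])
  then have "cyc a b c \<in> R_fin" "cyc a b c \<noteq> \<one>" by (auto simp: R_fin_def moved_def[of \<one>])
  then show ?thesis by blast
qed

text \<open>The permutations moving only the first \<open>n\<close> points of an enumeration form a
  finite subgroup, and these subgroups exhaust \<open>R_fin\<close>.\<close>

lemma amenable_R_fin:
  assumes "countable (UNIV :: 'x set)"
  shows "amenable (G\<lparr>carrier := R_fin\<rparr>)"
proof (rule amenable_increasing_union_finite)
  define D where "D n = {z :: 'x. to_nat_on UNIV z < n}" for n
  have D: "finite (D n)" for n
  proof (rule finite_imageD)
    show "finite (to_nat_on UNIV ` D n)" by (rule finite_subset[of _ "{..<n}"]) (auto simp: D_def)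
    show "inj_on (to_nat_on UNIV) (D n)" using inj_on_to_nat_on[OF assms] inj_on_subset by blast
  qed
  let ?F = "\<lambda>n. {g. moved g \<subseteq> D n}"
  show "group G" by (rule is_group)
  show "subgroup (?F n) G" for n
  proof
    show "x \<otimes> y \<in> ?F n" if "x \<in> ?F n" "y \<in> ?F n" for x y
      using that moved_mult[of x y] by blast
  qed (auto simp: moved_def[of \<one>])
  show "finite (?F n)" for n
  proof (rule finite_imageD)
    have "act ` ?F n \<subseteq> {f. f permutes D n}"
      using bij_act[unfolded bij_iff] by (fastforce simp: permutes_def moved_def)
    then show "finite (act ` ?F n)" using finite_permutations[OF D] finite_subset by blast
    show "inj_on act (?F n)" by (auto intro: inj_onI faithful)
  qed
  show "incseq ?F" by (auto simp: incseq_def D_def)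
  show "R_fin = (\<Union>n. ?F n)"
  proof (intro equalityI subsetI)
    fix g assume "g \<in> R_fin"
    then have fin: "finite (to_nat_on UNIV ` moved g)" by (simp add: R_fin_def)
    then have "moved g \<subseteq> D (Suc (Max (to_nat_on UNIV ` moved g)))"
      by (auto simp: D_def less_Suc_eq_le)
    then show "g \<in> (\<Union>n. ?F n)" by blast
  qed (use D finite_subset in \<open>auto simp: R_fin_def\<close>)
qed

end

section \<open>The group\<close>

text \<open>
  Left multiplication by the \<open>n\<close>-th generator in the free product of countably many copies of
  \<open>\<int>/2\<close>, whose elements are the words without equal adjacent letters; all other words are fixed.
\<close>

definition step :: "nat \<Rightarrow> nat list \<Rightarrow> nat list" where
  "step n w = (if distinct_adj w then (if w \<noteq> [] \<and> hd w = n then tl w else n # w) else w)"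

lemma step_reduced: "distinct_adj w \<Longrightarrow> distinct_adj (step n w)"
  by (cases w) (auto simp: step_def distinct_adj_Cons)

lemma step_step [simp]: "step n (step n w) = w"
proof (cases w)
  case (Cons a v)
  then show ?thesis by (cases v) (auto simp: step_def distinct_adj_Cons)
qed (simp add: step_def)

lemma foldr_step_rev: "foldr step (rev u) (foldr step u x) = x"
  by (induction u arbitrary: x) auto

lemma foldr_step_rev': "foldr step u (foldr step (rev u) x) = x"
  using foldr_step_rev[of "rev u"] by simp

lemma bij_foldr_step: "bij (foldr step u)"
  by (rule o_bij[of "foldr step (rev u)"]) (auto simp: fun_eq_iff foldr_step_rev foldr_step_rev')

text \<open>Cancelling a leading letter is compatible with composition because each
  \<open>step n\<close> is an involution; this is what makes reduction of words possible.\<close>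

lemma foldr_step_step:
  assumes "distinct_adj w"
  shows "step n (foldr step w x) = foldr step (step n w) x"
proof (cases "w \<noteq> [] \<and> hd w = n")
  case True
  then obtain v where "w = n # v" by (cases w) auto
  moreover from this have "step n w = v" using assms by (simp add: step_def)
  ultimately show ?thesis by simp
next
  case False
  then have "step n w = n # w" using assms by (auto simp: step_def)
  then show ?thesis by simp
qed

lemma foldr_step_reduce: "\<exists>w. distinct_adj w \<and> foldr step u = foldr step w"
proof (induction u)
  case Nil
  show ?case by (intro exI[of _ "[]"]) simp
next
  case (Cons n u)
  then obtain w where "distinct_adj w" "foldr step u = foldr step w" by blast
  then show ?case
    by (intro exI[of _ "step n w"]) (auto simp: step_reduced foldr_step_step fun_eq_iff)
qed

text \<open>No cancellation occurs inside a reduced word, so here the action is plain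
  prepending.\<close>

lemma foldr_step_append: "distinct_adj (w @ v) \<Longrightarrow> foldr step w v = w @ v"
  by (induction w) (auto simp: step_def distinct_adj_Cons dest: distinct_adj_ConsD)

definition word_permutations :: "(nat list \<Rightarrow> nat list) set" where
  "word_permutations = {f. bij f \<and> (\<exists>u. finite {x. f x \<noteq> foldr step u x})}"

text \<open>Such a permutation is coded by a word and the finite list of its exceptional
  values.\<close>

lemma countable_word_permutations: "countable word_permutations"
proof -
  define \<Phi> where "\<Phi> = (\<lambda>(u, ps) x. case map_of ps x of Some y \<Rightarrow> y | None \<Rightarrow> foldr step u x)"
  have "word_permutations \<subseteq> range \<Phi>"
  proof
    fix f assume "f \<in> word_permutations"
    then obtain u where u: "finite {x. f x \<noteq> foldr step u x}" by (auto simp: word_permutations_def)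
    then obtain xs where xs: "set xs = {x. f x \<noteq> foldr step u x}" using finite_list by blast
    have "f x = \<Phi> (u, map (\<lambda>x. (x, f x)) xs) x" for x
    proof (cases "x \<in> set xs")
      case True
      then show ?thesis by (simp add: \<Phi>_def map_of_map_restrict)
    next
      case False
      then have "f x = foldr step u x" unfolding xs by simp
      then show ?thesis using False by (simp add: \<Phi>_def map_of_map_restrict)
    qed
    then have "f = \<Phi> (u, map (\<lambda>x. (x, f x)) xs)" by (rule ext)
    then show "f \<in> range \<Phi>" by blast
  qed
  then show ?thesis by (rule countable_subset) (intro countable_image countableI_type)
qed

lemma word_permutations_comp:
  assumes "f \<in> word_permutations" "g \<in> word_permutations"
  shows "f \<circ> g \<in> word_permutations"
proof -
  obtain u v where f: "bij f" "finite {x. f x \<noteq> foldr step u x}"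
    and g: "bij g" "finite {x. g x \<noteq> foldr step v x}"
    using assms by (auto simp: word_permutations_def)
  have "{x. (f \<circ> g) x \<noteq> foldr step (u @ v) x} \<subseteq> {x. g x \<noteq> foldr step v x} \<union> g -` {x. f x \<noteq> foldr step u x}"
    by auto
  moreover have "finite (g -` {x. f x \<noteq> foldr step u x})"
    using f(2) g(1) by (intro finite_vimageI) (auto simp: bij_def)
  ultimately have "finite {x. (f \<circ> g) x \<noteq> foldr step (u @ v) x}"
    using g(2) finite_subset by blast
  then show ?thesis unfolding word_permutations_def using bij_comp[OF g(1) f(1)] by blast
qed

lemma word_permutations_inv:
  assumes "f \<in> word_permutations"
  shows "inv_into UNIV f \<in> word_permutations"
proof -
  obtain u where f: "bij f" "finite {x. f x \<noteq> foldr step u x}"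
    using assms by (auto simp: word_permutations_def)
  have "{y. inv_into UNIV f y \<noteq> foldr step (rev u) y} \<subseteq> f ` {x. f x \<noteq> foldr step u x}"
  proof
    fix y assume y: "y \<in> {y. inv_into UNIV f y \<noteq> foldr step (rev u) y}"
    define x where "x = inv_into UNIV f y"
    have "y = f x" using f(1) by (simp add: x_def bij_is_surj surj_f_inv_f)
    moreover have "f x \<noteq> foldr step u x"
    proof
      assume "f x = foldr step u x"
      then have "foldr step (rev u) y = x" using \<open>y = f x\<close> foldr_step_rev[of u x] by simp
      then show False using y by (simp add: x_def)
    qed
    ultimately show "y \<in> f ` {x. f x \<noteq> foldr step u x}" by blast
  qed
  then have "finite {y. inv_into UNIV f y \<noteq> foldr step (rev u) y}"
    using f(2) finite_subset by blast
  then show ?thesis using f(1) by (auto simp: word_permutations_def intro: bij_imp_bij_inv)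
qed

lemma finitary_word_permutation:
  "bij f \<Longrightarrow> finite {x. f x \<noteq> x} \<Longrightarrow> f \<in> word_permutations"
  unfolding word_permutations_def by (auto intro!: exI[of _ "[]"])

lemma foldr_step_word_permutation: "foldr step u \<in> word_permutations"
  unfolding word_permutations_def using bij_foldr_step by (auto intro!: exI[of _ u])

section \<open>Amenable normal subgroups of the word group\<close>

locale word_group = finitary_extension G act
  for G :: "'g monoid" (structure) and act :: "'g \<Rightarrow> nat list \<Rightarrow> nat list" +
  assumes range_act: "range act = word_permutations"
begin

lemma reduced_word: obtains w where "distinct_adj w" "finite {x. act g x \<noteq> foldr step w x}"
proof -
  have "act g \<in> word_permutations" unfolding range_act[symmetric] by (rule rangeI)
  then obtain u where "finite {x. act g x \<noteq> foldr step u x}" by (auto simp: word_permutations_def)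
  then show ?thesis using that foldr_step_reduce[of u] by metis
qed

text \<open>Varying the last letter gives infinitely many test words, of which only finitely many
  fall into the exceptional set.\<close>

lemma finite_bad_letters:
  assumes "finite {x. act g x \<noteq> foldr step w x}"
  shows "finite {n. act g (v @ [n]) \<noteq> foldr step w (v @ [n])}"
proof -
  have "{n. act g (v @ [n]) \<noteq> foldr step w (v @ [n])} = (\<lambda>n. v @ [n]) -` {x. act g x \<noteq> foldr step w x}"
    by auto
  then show ?thesis using finite_vimageI[OF assms, of "\<lambda>n. v @ [n]"] by (simp add: inj_def)
qed

text \<open>The reduced word \<open>w\<close> of an element \<open>k\<close> shows on one-letter
  words, since \<open>k\<close> sends \<open>[n]\<close> to \<open>w @ [n]\<close> for almost all
  \<open>n\<close>. If \<open>w\<close> does not begin with \<open>t i\<close>, then nothing cancels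
  when \<open>t i # u @ [t i]\<close> is applied to \<open>w @ [n]\<close>, as \<open>t i\<close>
  does not occur in \<open>u\<close>.\<close>

lemma not_amenable_if_not_finitary:
  assumes N: "N \<lhd> G" and g: "g \<in> N" "g \<notin> R_fin"
  shows "\<not> amenable (G\<lparr>carrier := N\<rparr>)"
proof
  assume am: "amenable (G\<lparr>carrier := N\<rparr>)"
  have sub: "subgroup N G" by (rule normal_imp_subgroup[OF N])
  obtain u where u: "distinct_adj u" "finite {x. act g x \<noteq> foldr step u x}" by (rule reduced_word)
  have u_ne: "u \<noteq> []" using g(2) u(2) by (auto simp: R_fin_def moved_def)
  \<comment> \<open>Letters beyond all those of \<open>u\<close>, distinct for distinct
    \<open>i\<close>.\<close>
  define t where "t i = Suc (Max (set u)) + i" for i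
  have t: "t i \<notin> set u" for i
  proof
    assume "t i \<in> set u"
    then have "t i \<le> Max (set u)" by simp
    then show False by (simp add: t_def)
  qed
  have "\<forall>i. \<exists>s. act s = step (t i)"
  proof
    fix i
    have "foldr step [t i] \<in> range act" unfolding range_act by (rule foldr_step_word_permutation)
    then show "\<exists>s. act s = step (t i)" by (auto simp: fun_eq_iff image_iff)
  qed
  then obtain s where s: "\<And>i. act (s i) = step (t i)" by metis
  have s_inv: "inv (s i) = s i" for i
    by (rule inv_equality) (auto intro: act_eqI simp: act_mult s)
  define h where "h i = s i \<otimes> g \<otimes> s i" for i
  have h: "h i \<in> N" for i
    using normal.inv_op_closed2[OF N _ g(1), of "s i"] by (simp add: h_def s_inv)
  have act_h: "finite {x. act (h i) x \<noteq> foldr step (t i # u @ [t i]) x}" for i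
  proof -
    have "{x. act (h i) x \<noteq> foldr step (t i # u @ [t i]) x} \<subseteq> step (t i) -` {x. act g x \<noteq> foldr step u x}"
      by (auto simp: h_def act_mult s)
    moreover have "inj (step (t i))" using bij_act[of "s i"] by (simp add: s bij_def)
    ultimately show ?thesis by (rule finite_subset[OF _ finite_vimageI[OF u(2)]])
  qed
  \<comment> \<open>Membership says that the reduced word of \<open>k\<close> begins with
    \<open>t i\<close>; discarding finitely many \<open>n\<close> makes this insensitive to finitary
    changes. An element whose reduced word is empty lies in no \<open>Y i\<close>.\<close>
  define Y where "Y i = {k \<in> N. finite {n. \<not> (act k [n] \<noteq> [] \<and> hd (act k [n]) = t i)}}" for i :: nat
  show False
  proof (rule not_amenable_of_three_halves[OF is_group sub am])
    show "Y i \<subseteq> N" "h i \<in> N" for i by (auto simp: Y_def h)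
    show "Y i \<inter> Y j = {}" if "i \<noteq> j" for i j
    proof (rule ccontr)
      assume "Y i \<inter> Y j \<noteq> {}"
      then obtain k where "k \<in> Y i" "k \<in> Y j" by blast
      then have "finite ({n. \<not> (act k [n] \<noteq> [] \<and> hd (act k [n]) = t i)} \<union>
          {n. \<not> (act k [n] \<noteq> [] \<and> hd (act k [n]) = t j)})" (is "finite ?U")
        by (simp only: Y_def mem_Collect_eq finite_Un)
      moreover have "?U = UNIV" using that by (auto simp: t_def)
      ultimately show False by (simp only: infinite_UNIV_nat)
    qed
    show "h i \<otimes> k \<in> Y i" if k: "k \<in> N - Y i" for i k
    proof -
      obtain w where w: "distinct_adj w" "finite {x. act k x \<noteq> foldr step w x}" by (rule reduced_word)
      have bad_k: "finite (set w \<union> {n. act k [n] \<noteq> foldr step w [n]})"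
        using finite_bad_letters[OF w(2), of "[]"] by simp
      have act_k: "act k [n] = w @ [n]" if "n \<notin> set w \<union> {n. act k [n] \<noteq> foldr step w [n]}" for n
      proof -
        have "w = [] \<or> last w \<noteq> n" using that by (metis UnI1 last_in_set)
        then have "distinct_adj (w @ [n])" using w(1) by (simp add: distinct_adj_append_iff)
        then show ?thesis using that foldr_step_append by simp
      qed
      have w_t: "w = [] \<or> hd w \<noteq> t i"
      proof (rule ccontr)
        assume neg: "\<not> (w = [] \<or> hd w \<noteq> t i)"
        have "{n. \<not> (act k [n] \<noteq> [] \<and> hd (act k [n]) = t i)} \<subseteq> set w \<union> {n. act k [n] \<noteq> foldr step w [n]}"
        proof (rule subsetI, rule ccontr)
          fix n assume n: "n \<in> {n. \<not> (act k [n] \<noteq> [] \<and> hd (act k [n]) = t i)}"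
            "n \<notin> set w \<union> {n. act k [n] \<noteq> foldr step w [n]}"
          show False using n(1) neg unfolding mem_Collect_eq act_k[OF n(2)] by simp
        qed
        from finite_subset[OF this bad_k] have "k \<in> Y i" using k unfolding Y_def by blast
        then show False using k by simp
      qed
      \<comment> \<open>The letter \<open>t i\<close> itself must be excluded for the case of empty
        \<open>w\<close>, where \<open>n\<close> directly follows \<open>t i\<close>.\<close>
      let ?bad = "{t i} \<union> (set w \<union> {n. act k [n] \<noteq> foldr step w [n]})
        \<union> {n. act (h i) (w @ [n]) \<noteq> foldr step (t i # u @ [t i]) (w @ [n])}"
      have "act (h i \<otimes> k) [n] = (t i # u @ [t i]) @ w @ [n]" if n: "n \<notin> ?bad" for n
      proof -
        have "act (h i \<otimes> k) [n] = foldr step (t i # u @ [t i]) (w @ [n])"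
          using n act_k[of n] by (auto simp: act_mult)
        also have "\<dots> = (t i # u @ [t i]) @ w @ [n]"
        proof (rule foldr_step_append)
          have "hd u \<noteq> t i" using t[of i] hd_in_set[OF u_ne] by auto
          have "last u \<noteq> t i" using t[of i] last_in_set[OF u_ne] by auto
          have "w = [] \<or> last w \<noteq> n" using n last_in_set[of w] by auto
          moreover have "t i \<noteq> hd (w @ [n])" using n w_t by (cases w) auto
          ultimately have "distinct_adj (t i # w @ [n])"
            using w(1) by (simp add: distinct_adj_append_iff distinct_adj_Cons)
          then have "distinct_adj (u @ t i # w @ [n])"
            using u(1) \<open>last u \<noteq> t i\<close> by (simp add: distinct_adj_append_iff)
          moreover have "t i \<noteq> hd (u @ t i # w @ [n])" using u_ne \<open>hd u \<noteq> t i\<close> by simp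
          ultimately have "distinct_adj (t i # u @ t i # w @ [n])"
            unfolding distinct_adj_Cons by blast
          then show "distinct_adj ((t i # u @ [t i]) @ w @ [n])" by simp
        qed
        finally show ?thesis .
      qed
      then have "{n. \<not> (act (h i \<otimes> k) [n] \<noteq> [] \<and> hd (act (h i \<otimes> k) [n]) = t i)} \<subseteq> ?bad" by auto
      moreover have "finite ?bad" using bad_k finite_bad_letters[OF act_h] by simp
      ultimately have "finite {n. \<not> (act (h i \<otimes> k) [n] \<noteq> [] \<and> hd (act (h i \<otimes> k) [n]) = t i)}"
        by (rule finite_subset)
      moreover have "h i \<otimes> k \<in> N" using h k subgroup.m_closed[OF sub] by auto
      ultimately show ?thesis unfolding Y_def by blast
    qed
  qed
qed

lemma amenable_radical: "is_amenable_radical G R_fin"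
  unfolding is_amenable_radical_def
  using normal_R_fin amenable_R_fin not_amenable_if_not_finitary by blast

lemma not_amenable: "\<not> amenable G"
proof -
  obtain g where g: "act g = step 0"
    using foldr_step_word_permutation[of "[0]"] unfolding range_act[symmetric] by (auto simp: comp_def)
  have "range (\<lambda>n. [Suc n]) \<subseteq> moved g"
    by (auto simp: moved_def g step_def)
  moreover have "infinite (range (\<lambda>n. [Suc n]))"
    by (intro range_inj_infinite) (auto simp: inj_def)
  ultimately have "g \<notin> R_fin" using finite_subset by (auto simp: R_fin_def)
  moreover have "UNIV \<lhd> G" using subgroup_self by (simp add: normal_inv_iff)
  ultimately have "\<not> amenable (G\<lparr>carrier := UNIV\<rparr>)"
    by (intro not_amenable_if_not_finitary) auto
  moreover have "G\<lparr>carrier := UNIV\<rparr> = G" unfolding carrier_UNIV[symmetric] by simp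
  ultimately show ?thesis by simp
qed

end

text \<open>The permutations form a countably infinite set, so composition can be transported along
  an enumeration by \<open>nat\<close>; the enumeration itself becomes the action.\<close>

lemma ex_word_group: "\<exists>(G :: nat monoid) act. word_group G act"
proof -
  have inf: "infinite word_permutations"
  proof -
    have "inj (\<lambda>n. foldr step [n])"
    proof (rule injI)
      fix m n assume "foldr step [m] = foldr step [n]"
      then have "foldr step [m] [] = foldr step [n] []" by simp
      then show "m = n" by (simp add: step_def)
    qed
    then have "infinite (range (\<lambda>n. foldr step [n]))" by (rule range_inj_infinite)
    moreover have "range (\<lambda>n. foldr step [n]) \<subseteq> word_permutations"
      using foldr_step_word_permutation by blast
    ultimately show ?thesis using finite_subset by blast
  qed
  define act where "act = from_nat_into word_permutations"
  have bij: "bij_betw act UNIV word_permutations"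
    unfolding act_def by (rule bij_betw_from_nat_into[OF countable_word_permutations inf])
  define enc where "enc = inv_into UNIV act"
  have enc: "act (enc f) = f" if "f \<in> word_permutations" for f
    using bij that by (simp add: enc_def bij_betw_def f_inv_into_f)
  have act_in: "act n \<in> word_permutations" for n using bij by (auto simp: bij_betw_def)
  have faithful: "m = n" if "act m = act n" for m n
    using bij that by (auto simp: bij_betw_def inj_def)
  have id_in: "id \<in> word_permutations" by (rule finitary_word_permutation) auto
  define G :: "nat monoid" where "G = \<lparr>carrier = UNIV, mult = \<lambda>m n. enc (act m \<circ> act n), one = enc id\<rparr>"
  have mult: "act (m \<otimes>\<^bsub>G\<^esub> n) = act m \<circ> act n" for m n
    by (simp add: G_def enc word_permutations_comp act_in)
  have one: "act \<one>\<^bsub>G\<^esub> = id" by (simp add: G_def enc id_in)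
  have bij_act: "bij (act n)" for n using act_in[of n] by (simp add: word_permutations_def)
  have grp: "group G"
  proof (rule groupI)
    fix x y z
    show "x \<otimes>\<^bsub>G\<^esub> y \<otimes>\<^bsub>G\<^esub> z = x \<otimes>\<^bsub>G\<^esub> (y \<otimes>\<^bsub>G\<^esub> z)" by (rule faithful) (simp add: mult comp_assoc)
    show "\<one>\<^bsub>G\<^esub> \<otimes>\<^bsub>G\<^esub> x = x" by (rule faithful) (simp add: mult one)
    have "enc (inv_into UNIV (act x)) \<otimes>\<^bsub>G\<^esub> x = \<one>\<^bsub>G\<^esub>"
      by (rule faithful) (simp add: mult one enc word_permutations_inv act_in bij_act bij_is_inj)
    then show "\<exists>y\<in>carrier G. y \<otimes>\<^bsub>G\<^esub> x = \<one>\<^bsub>G\<^esub>" by (auto simp: G_def)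
  qed (auto simp: G_def)
  have "word_group G act"
  proof (intro word_group.intro finitary_extension.intro group_on_UNIV.intro grp
      group_on_UNIV_axioms.intro finitary_extension_axioms.intro word_group_axioms.intro)
    show "carrier G = UNIV" by (simp add: G_def)
    show "infinite (UNIV :: nat list set)" by (rule infinite_UNIV_listI)
    show "range act = word_permutations" using bij by (simp add: bij_betw_def)
    then show "f \<in> range act" if "bij f" "finite {z. f z \<noteq> z}" for f
      using finitary_word_permutation[OF that] by simp
  qed (auto simp: bij_act mult faithful)
  then show ?thesis by blast
qed

theorem theorem2:
  shows "\<exists>G :: nat monoid.
    group G \<and> countable (carrier G) \<and> \<not> amenable G \<and>
    (\<exists>R. is_amenable_radical G R \<and> R \<noteq> {\<one>\<^bsub>G\<^esub>}) \<and>
    ISR_property G"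
proof -
  obtain G :: "nat monoid" and act where "word_group G act" using ex_word_group by blast
  then interpret word_group G act .
  show ?thesis
    using is_group not_amenable amenable_radical R_fin_nontrivial ISR_property by auto
qed

end
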